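(* Let $1<p<\infty$, $0<\theta<1$, $1\le r<\infty$, $Z_{\theta,r}=\bigl(L^{p)}(\Omega),L^{(p}(\Omega)\bigr)_{\theta,r}$ and $\beta_\theta=\theta-\frac1p-\frac1r$. Then, with constants independent of $f$: (i) if $\theta<\frac1p$, $\|f\|_{Z_{\theta,r}}\approx\Bigl(\int_0^1\Bigl[(1-\log t)^{\beta_\theta}\bigl(\int_t^1 f_*^p(s)ds\bigr)^{1/p}\Bigr]^r\frac{dt}{t}\Bigr)^{1/r}$; (ii) if $\theta>\frac1p$, $\|f\|_{Z_{\theta,r}}\approx\Bigl(\int_0^1\Bigl[(1-\log t)^{\beta_\theta}\bigl(\int_0^t f_*^p(s)ds\bigr)^{1/p}\Bigr]^r\frac{dt}{t}\Bigr)^{1/r}$; (iii) if $\theta=\frac1p$, $\|f\|_{Z_{\theta,r}}\approx\Bigl[\sum_{k=0}^{\infty}\Bigl(\int_{2^{1-2^{k+1}}}^{2^{1-2^k}}f_*^p(s)ds\Bigr)^{r/p}\Bigr]^{1/r}$. In particular $\bigl(L^{p)},L^{(p}\bigr)_{\frac1p,p}=L^p(\Omega)$ and $\bigl(L^{p)},L^{(p}\bigr)_{\theta,p}=L^{p,p}(\log L)^{\theta-\frac1p}$ for $0<\theta<1$, with equivalent norms.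
   Context: $\Omega\subset\mathbb R^n$ is a bounded open set with $|\Omega|=1$; $f_*$ is the decreasing rearrangement of $|f|$ on $(0,1)$; $\log$ is the natural logarithm. Grand Lebesgue space $L^{p)}(\Omega)$: measurable $f$ with $\|f\|_{p)}=\sup_{0<t<1}(1-\log t)^{-1/p}(\int_t^1 f_*^p)^{1/p}<\infty$. Small Lebesgue space $L^{(p}(\Omega)$: measurable $f$ with $\|f\|_{(p}=\int_0^1(1-\log t)^{-1/p}(\int_0^t f_*^p)^{1/p}\frac{dt}{t}<\infty$. Lorentz–Zygmund space $L^{a,r}(\log L)^{\beta}$: measurable $f$ with $\bigl(\int_0^1[t^{1/a}(1-\log t)^{\beta}f_*(t)]^r\frac{dt}{t}\bigr)^{1/r}<\infty$. K-functional: $K(g,t;X_0,X_1)=\inf_{g=g_0+g_1}(\|g_0\|_{X_0}+t\|g_1\|_{X_1})$; $(X_0,X_1)_{\theta,r}$ is the set of $g\in X_0+X_1$ with $\|g\|=\bigl(\int_0^1[t^{-\theta}K(g,t)]^r\frac{dt}{t}\bigr)^{1/r}<\infty$ (only $t\in(0,1)$ used). *)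

theory Defs
  imports "HOL-Analysis.Analysis"
begin

text \<open>Real powers of extended nonnegative reals (used only with positive exponents):
  infinity stays infinity, otherwise the usual real power.\<close>
definition epow :: "ennreal \<Rightarrow> real \<Rightarrow> ennreal" where
  "epow x a = (if x = top then top else ennreal (enn2real x powr a))"

definition distf :: "'a::euclidean_space set \<Rightarrow> ('a \<Rightarrow> real) \<Rightarrow> real \<Rightarrow> ennreal" where
  "distf \<Omega> f y = emeasure (lebesgue_on \<Omega>) {x \<in> \<Omega>. y < \<bar>f x\<bar>}"

definition rearr :: "'a::euclidean_space set \<Rightarrow> ('a \<Rightarrow> real) \<Rightarrow> real \<Rightarrow> real" where
  "rearr \<Omega> f t = Inf {y. 0 \<le> y \<and> distf \<Omega> f y \<le> ennreal t}"

definition meas_fun :: "'a::euclidean_space set \<Rightarrow> ('a \<Rightarrow> real) set" where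
  "meas_fun \<Omega> = borel_measurable (lebesgue_on \<Omega>)"

definition rint :: "'a::euclidean_space set \<Rightarrow> real \<Rightarrow> ('a \<Rightarrow> real) \<Rightarrow> real set \<Rightarrow> ennreal" where
  "rint \<Omega> p f A = (\<integral>\<^sup>+ s. indicator A s * ennreal (rearr \<Omega> f s powr p) \<partial>lborel)"

definition grand_norm :: "real \<Rightarrow> 'a::euclidean_space set \<Rightarrow> ('a \<Rightarrow> real) \<Rightarrow> ennreal" where
  "grand_norm p \<Omega> f = (SUP t\<in>{0<..<1}. ennreal ((1 - ln t) powr (-1/p)) * epow (rint \<Omega> p f {t..1}) (1/p))"

definition small_norm :: "real \<Rightarrow> 'a::euclidean_space set \<Rightarrow> ('a \<Rightarrow> real) \<Rightarrow> ennreal" where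
  "small_norm p \<Omega> f = (\<integral>\<^sup>+ t. indicator {0<..<1} t * ennreal ((1 - ln t) powr (-1/p) / t)
        * epow (rint \<Omega> p f {0..t}) (1/p) \<partial>lborel)"

definition LZ_norm :: "real \<Rightarrow> real \<Rightarrow> real \<Rightarrow> 'a::euclidean_space set \<Rightarrow> ('a \<Rightarrow> real) \<Rightarrow> ennreal" where
  "LZ_norm a r \<beta> \<Omega> f = epow (\<integral>\<^sup>+ t. indicator {0<..<1} t *
        ennreal ((t powr (1/a) * (1 - ln t) powr \<beta> * rearr \<Omega> f t) powr r / t) \<partial>lborel) (1/r)"

definition Lp_norm :: "real \<Rightarrow> 'a::euclidean_space set \<Rightarrow> ('a \<Rightarrow> real) \<Rightarrow> ennreal" where
  "Lp_norm p \<Omega> f = epow (\<integral>\<^sup>+ x. ennreal (\<bar>f x\<bar> powr p) \<partial>lebesgue_on \<Omega>) (1/p)"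

definition Kfun :: "'a::euclidean_space set \<Rightarrow> (('a \<Rightarrow> real) \<Rightarrow> ennreal) \<Rightarrow> (('a \<Rightarrow> real) \<Rightarrow> ennreal)
    \<Rightarrow> ('a \<Rightarrow> real) \<Rightarrow> real \<Rightarrow> ennreal" where
  "Kfun \<Omega> N0 N1 g t = Inf {N0 g0 + ennreal t * N1 g1 | g0 g1.
       g0 \<in> meas_fun \<Omega> \<and> g1 \<in> meas_fun \<Omega> \<and> (\<forall>x\<in>\<Omega>. g x = g0 x + g1 x)}"

definition interp_norm :: "'a::euclidean_space set \<Rightarrow> (('a \<Rightarrow> real) \<Rightarrow> ennreal) \<Rightarrow> (('a \<Rightarrow> real) \<Rightarrow> ennreal)
    \<Rightarrow> real \<Rightarrow> real \<Rightarrow> ('a \<Rightarrow> real) \<Rightarrow> ennreal" where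
  "interp_norm \<Omega> N0 N1 \<theta> r g = epow (\<integral>\<^sup>+ t. indicator {0<..<1} t *
       epow (ennreal (t powr (-\<theta>)) * Kfun \<Omega> N0 N1 g t) r / ennreal t \<partial>lborel) (1/r)"

definition equiv_on :: "('b set) \<Rightarrow> ('b \<Rightarrow> ennreal) \<Rightarrow> ('b \<Rightarrow> ennreal) \<Rightarrow> bool" where
  "equiv_on F N M \<longleftrightarrow> (\<exists>c C. 0 < c \<and> 0 < C \<and>
      (\<forall>f\<in>F. ennreal c * M f \<le> N f \<and> N f \<le> ennreal C * M f))"

end

(* Cut (0,1) at a_k = 2^(1-2^k) and let b_k(f) be the L^p norm of the rearrangement of f on
   [a_(k+1), a_k]. Since 1 - log t is about 2^k there, the small norm is equivalent to the weighted
   l^1 norm sum_k 2^(k(1-1/p)) b_k, and the grand norm lies between sup_k 2^(-k/p) b_k and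
   sum_k 2^(-k/p) b_k, up to constants. Splitting f at the level f_*(a_k) gives

     K(f, 2^-k) <= C (2^-k sum_(j<=k) 2^(j(1-1/p)) b_j + sum_(j>=k) 2^(-j/p) b_j),

   while f_*(2s) <= g_*(s) + h_*(s) for f = g + h gives K(f, 2^-k) >= c 2^(-k/p) b_k. A discrete
   Hardy inequality makes the two bounds agree after taking weighted l^r norms, so the interpolation
   norm is equivalent to (sum_k (2^(k(theta-1/p)) b_k)^r)^(1/r). All the right-hand sides discretize
   to this expression in the same way. *)
theory Submission
  imports Defs
begin

subsection \<open>Real powers of extended nonnegative reals\<close>

text \<open>The sign of \<open>\<theta> - 1/p\<close> matters only for the integral forms:
  collapsing the partial sums hidden in an integral over \<open>(t, 1)\<close> or
  \<open>(0, t)\<close> takes a Hardy inequality with weight exponent \<open>\<theta> - 1/p\<close>,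
  which must be nonzero, so the critical case stays a sum over blocks. The K-functional bound uses
  Hardy with exponents \<open>\<theta> - 1\<close> and \<open>\<theta>\<close>, nonzero whenever
  \<open>0 < \<theta> < 1\<close>, so one block formula covers every \<open>\<theta>\<close>; the
  same slack absorbs the gap between sup and sum in the grand norm. The cut points decay doubly
  exponentially so that \<open>1 - ln t\<close> roughly doubles from one to the next. This turns
  logarithmic weights into powers of 2, matches block k with the parameter 2^-k at which the weights
  of the two norms balance, and makes the bounded part of the truncation negligible past block k.
  Block k then has mass 2^k ln 2 for dt/t, which the \<open>- 1/r\<close> in the exponent
  compensates. All bounds are in \<open>ennreal\<close>, so finiteness is transferred along with
  them.\<close>

lemma epow_ennreal: "0 \<le> x \<Longrightarrow> epow (ennreal x) a = ennreal (x powr a)"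
  by (simp add: epow_def)

lemma epow_top [simp]: "epow top a = top"
  by (simp add: epow_def)

lemma epow_0 [simp]: "epow 0 a = 0"
  by (simp add: epow_def)

lemma epow_1 [simp]: "epow x 1 = x"
  by (cases x) (auto simp: epow_ennreal)

lemma epow_mono:
  assumes "x \<le> y" "0 \<le> a"
  shows "epow x a \<le> epow y a"
  using assms by (cases x; cases y) (auto simp: epow_ennreal top_unique intro!: ennreal_leI powr_mono2)

lemma epow_mult:
  "epow (x * y) a = epow x a * epow y a"
proof (cases "x = 0 \<or> y = 0")
  case False
  then show ?thesis
    by (cases x; cases y)
      (auto simp: epow_ennreal ennreal_mult[symmetric] ennreal_mult_top ennreal_top_mult powr_mult
        ennreal_mult_eq_top_iff)
qed auto

lemma epow_epow: "epow (epow x a) b = epow x (a * b)"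
  by (cases x) (auto simp: epow_ennreal powr_powr)

lemma epow_add: "x \<noteq> 0 \<Longrightarrow> epow x (a + b) = epow x a * epow x b"
  by (cases x) (auto simp: epow_ennreal powr_add ennreal_mult[symmetric])

lemma le_suminf_ennreal: "x k \<le> (\<Sum>k. x k :: ennreal)"
  using sum_le_suminf[of x "{k}"] by (simp add: summableI)

text \<open>Each term is at most the total \<open>S\<close>, so \<open>y j ^ p\<close> is at most
  \<open>y j * S ^ (p - 1)\<close>, and summing gives \<open>S ^ p\<close>. This passes from
  integrals, which add over blocks, to block norms.\<close>

lemma epow_suminf_le:
  assumes "1 \<le> p"
  shows "epow (\<Sum>j. x j) (1/p) \<le> (\<Sum>j. epow (x j) (1/p))"
proof -
  define y where "y j = epow (x j) (1/p)" for j
  define S where "S = (\<Sum>j. y j)"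
  have x: "x j = epow (y j) p" for j
    using assms by (simp add: y_def epow_epow)
  have le: "y j \<le> S" for j
    unfolding S_def by (rule le_suminf_ennreal)
  have "epow (y j) p \<le> y j * epow S (p - 1)" for j
  proof (cases "y j = 0")
    case False
    then have "epow (y j) p = y j * epow (y j) (p - 1)"
      using epow_add[of "y j" 1 "p - 1"] by simp
    then show ?thesis
      using assms by (auto intro!: mult_left_mono epow_mono le)
  qed simp
  then have "(\<Sum>j. x j) \<le> (\<Sum>j. y j * epow S (p - 1))"
    unfolding x by (intro suminf_le summableI)
  also have "\<dots> = S * epow S (p - 1)"
    by (simp add: S_def)
  also have "\<dots> = epow S p"
    using epow_add[of S 1 "p - 1"] by (cases "S = 0") auto
  finally have "epow (\<Sum>j. x j) (1/p) \<le> epow (epow S p) (1/p)"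
    using assms by (intro epow_mono) auto
  then show ?thesis
    using assms by (simp add: epow_epow S_def y_def)
qed

lemma epow_add_le:
  assumes "1 \<le> p"
  shows "epow (x + y) (1/p) \<le> epow x (1/p) + epow y (1/p)"
proof -
  have *: "(\<Sum>j. if j = (0::nat) then a else if j = 1 then b else 0) = a + b" for a b :: ennreal
    by (subst suminf_finite[of "{0, 1}"]) auto
  have "epow (x + y) (1/p) = epow (\<Sum>j. if j = (0::nat) then x else if j = 1 then y else 0) (1/p)"
    by (simp only: *)
  also have "\<dots> \<le> (\<Sum>j. epow (if j = (0::nat) then x else if j = 1 then y else 0) (1/p))"
    by (rule epow_suminf_le[OF assms])
  also have "\<dots> = (\<Sum>j. if j = (0::nat) then epow x (1/p) else if j = 1 then epow y (1/p) else 0)"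
    by (intro suminf_cong) auto
  finally show ?thesis
    by (simp only: *)
qed

text \<open>If \<open>x > T\<close>, then \<open>(x / T) powr (r - 1)\<close> is at least 1. The
  free level \<open>T\<close> makes this a substitute for Jensen's inequality: the linear bound is
  summed first and \<open>T\<close> chosen afterwards.\<close>

lemma le_tangent_powr:
  fixes x T r :: real
  assumes "0 \<le> x" "0 < T" "1 \<le> r"
  shows "x \<le> T + T powr (1 - r) * x powr r"
proof (cases "x \<le> T")
  case True
  then show ?thesis using assms by (simp add: add_increasing2)
next
  case False
  then have "x = x powr (1 - r) * x powr r"
    using assms by (simp add: powr_add[symmetric])
  also have "\<dots> \<le> T powr (1 - r) * x powr r"
    using False assms by (intro mult_right_mono powr_mono2') auto
  finally show ?thesis
    using assms by simp
qed

text \<open>Jensen's inequality for weights of total mass at most \<open>W\<close>, up to the factor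
  \<open>2 powr r\<close>.\<close>

lemma epow_weighted_suminf_le:
  fixes w x :: "nat \<Rightarrow> ennreal"
  assumes r: "1 \<le> r" and W: "0 < W" and w: "(\<Sum>j. w j) \<le> ennreal W"
  shows "epow (\<Sum>j. w j * x j) r \<le> ennreal (2 powr r * W powr (r - 1)) * (\<Sum>j. w j * epow (x j) r)"
proof -
  define S where "S = (\<Sum>j. w j * x j)"
  define Q where "Q = (\<Sum>j. w j * epow (x j) r)"
  have S_le: "S \<le> ennreal (W * T) + ennreal (T powr (1 - r)) * Q" if "0 < T" for T
  proof -
    have "w j * x j \<le> w j * ennreal T + ennreal (T powr (1 - r)) * (w j * epow (x j) r)" for j
    proof -
      have "x j \<le> ennreal T + ennreal (T powr (1 - r)) * epow (x j) r"
        using le_tangent_powr[OF _ \<open>0 < T\<close> r] \<open>0 < T\<close>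
        by (cases "x j") (auto simp: epow_ennreal ennreal_mult[symmetric] ennreal_plus[symmetric]
            ennreal_mult_top simp del: ennreal_plus intro!: ennreal_leI)
      then have "w j * x j \<le> w j * (ennreal T + ennreal (T powr (1 - r)) * epow (x j) r)"
        by (rule mult_left_mono) simp
      then show ?thesis by (simp add: algebra_simps)
    qed
    then have "S \<le> (\<Sum>j. w j * ennreal T + ennreal (T powr (1 - r)) * (w j * epow (x j) r))"
      unfolding S_def by (intro suminf_le summableI)
    also have "\<dots> = (\<Sum>j. w j) * ennreal T + ennreal (T powr (1 - r)) * Q"
      unfolding Q_def by (subst suminf_add[symmetric]) (auto intro: summableI)
    also have "\<dots> \<le> ennreal W * ennreal T + ennreal (T powr (1 - r)) * Q"
      by (intro add_mono mult_right_mono w) auto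
    finally show ?thesis
      using W that by (simp add: ennreal_mult)
  qed
  show ?thesis
  proof (cases "S = 0 \<or> Q = top")
    case True
    then show ?thesis
      using W by (auto simp: S_def[symmetric] Q_def[symmetric] ennreal_mult_top)
  next
    case False
    then obtain q where q: "0 \<le> q" "Q = ennreal q"
      by (cases Q) auto
    \<comment> \<open>Any level \<open>T\<close> shows that \<open>S\<close> is finite, as the
      absorption below requires.\<close>
    have "S \<noteq> top"
      using S_le[of 1] q by (auto simp: ennreal_mult[symmetric] top_unique)
    then obtain s where s: "0 < s" "S = ennreal s"
      using False by (cases S) (auto simp: order_less_le)
    \<comment> \<open>With this level \<open>W * T\<close> is half of \<open>s\<close>, so the
      linear term can be absorbed into the left-hand side.\<close>
    define T where "T = s / (2 * W)"
    have T: "0 < T" using s W by (simp add: T_def)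
    have "ennreal s \<le> ennreal (W * T + T powr (1 - r) * q)"
      using S_le[OF T] q s W T by (simp add: ennreal_mult)
    then have "s \<le> W * T + T powr (1 - r) * q"
      using q W T by (subst (asm) ennreal_le_iff) auto
    then have "W * T \<le> T powr (1 - r) * q"
      using W by (simp add: T_def field_simps)
    then have "T powr (r - 1) * (W * T) \<le> T powr (r - 1) * (T powr (1 - r) * q)"
      by (rule mult_left_mono) simp
    also have "\<dots> = q"
      using T by (simp add: powr_add[symmetric] mult.assoc[symmetric])
    also have "T powr (r - 1) * (W * T) = W * T powr r"
      using T powr_add[of T "r - 1" 1] by (simp add: mult_ac)
    also have "\<dots> = s powr r / (2 powr r * W powr (r - 1))"
      using s W by (simp add: T_def powr_divide powr_mult powr_diff field_simps)
    finally have "s powr r \<le> 2 powr r * W powr (r - 1) * q"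
      using W by (simp add: field_simps)
    then show ?thesis
      using q s by (simp add: S_def[symmetric] Q_def[symmetric] epow_ennreal
          ennreal_mult[symmetric] ennreal_leI)
  qed
qed

lemma epow_add_le_const:
  assumes "1 \<le> r"
  shows "epow (x + y) r \<le> ennreal (2 powr r * 2 powr (r - 1)) * (epow x r + epow y r)"
proof -
  let ?w = "\<lambda>j. if j < (2::nat) then 1 else 0 :: ennreal"
  let ?x = "\<lambda>j. if j = (0::nat) then x else y"
  have *: "(\<Sum>j. ?w j * z j) = z 0 + z 1" for z
    by (subst suminf_finite[of "{0, 1}"]) auto
  have "(\<Sum>j. ?w j) \<le> ennreal 2"
    using *[of "\<lambda>_. 1"] by simp
  from epow_weighted_suminf_le[OF assms _ this, of ?x] show ?thesis
    unfolding * by simp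
qed

subsection \<open>Geometrically decaying kernels\<close>

lemma suminf_swap_ennreal:
  fixes f :: "nat \<Rightarrow> nat \<Rightarrow> ennreal"
  shows "(\<Sum>i. \<Sum>j. f i j) = (\<Sum>j. \<Sum>i. f i j)"
proof -
  have "(\<Sum>i. \<Sum>j. f i j) = (\<integral>\<^sup>+i. (\<Sum>j. f i j) \<partial>count_space UNIV)"
    by (simp add: nn_integral_count_space_nat)
  also have "\<dots> = (\<Sum>j. \<integral>\<^sup>+i. f i j \<partial>count_space UNIV)"
    by (rule nn_integral_suminf) simp
  finally show ?thesis
    by (simp add: nn_integral_count_space_nat)
qed

text \<open>The indices below \<open>k\<close> and those from \<open>k\<close> on each contribute at
  most one geometric series, hence the 2 and the uniformity in \<open>k\<close>.\<close>

lemma suminf_geometric_kernel_le: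
  fixes q :: real
  assumes "0 < q" "q < 1"
  shows "(\<Sum>j. ennreal (q ^ nat \<bar>int k - int j\<bar>)) \<le> ennreal (2 / (1 - q))"
proof -
  have s: "summable (\<lambda>j. q ^ j)" "(\<Sum>j. q ^ j) = 1 / (1 - q)"
    using assms by (auto simp: suminf_geometric)
  have "(\<Sum>j<n. q ^ nat \<bar>int k - int j\<bar>) \<le> 2 / (1 - q)" for n
  proof -
    have "(\<Sum>j<n. q ^ nat \<bar>int k - int j\<bar>)
      \<le> (\<Sum>j<k+n. q ^ nat \<bar>int k - int j\<bar>)"
      using assms by (intro sum_mono2) auto
    also have "\<dots> = (\<Sum>j<k. q ^ nat \<bar>int k - int j\<bar>) + (\<Sum>j<n. q ^ j)"
      using sum.atLeastLessThan_concat[of 0 k "k + n" "\<lambda>j. q ^ nat \<bar>int k - int j\<bar>"]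
        sum.shift_bounds_nat_ivl[of "\<lambda>j. q ^ nat \<bar>int k - int j\<bar>" 0 k n]
      by (simp add: atLeast0LessThan add.commute)
    also have "(\<Sum>j<k. q ^ nat \<bar>int k - int j\<bar>) = (\<Sum>j<k. q ^ Suc j)"
      by (subst sum.nat_diff_reindex[symmetric])
        (auto intro!: sum.cong arg_cong[where f = "\<lambda>n. q ^ n"] simp del: power_Suc)
    also have "\<dots> \<le> (\<Sum>j<k. q ^ j)"
      using assms by (intro sum_mono) (simp add: mult_left_le_one_le)
    also have "\<dots> \<le> (\<Sum>j. q ^ j)"
      using s assms by (intro sum_le_suminf) auto
    also have "(\<Sum>j<n. q ^ j) \<le> (\<Sum>j. q ^ j)"
      using s assms by (intro sum_le_suminf) auto
    finally show ?thesis using s by simp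
  qed
  then show ?thesis
    using assms
    by (intro suminf_le_const summableI) (auto simp: sum_ennreal intro!: ennreal_leI)
qed

text \<open>Schur test: Jensen is applied in each row, then the sums are exchanged. The kernel is
  symmetric, so the same mass bound serves rows and columns.\<close>

lemma schur_geometric:
  fixes q r :: real
  assumes q: "0 < q" "q < 1" and r: "1 \<le> r"
  obtains C where "0 < C"
    "\<And>c :: nat \<Rightarrow> ennreal. (\<Sum>k. epow (\<Sum>j. ennreal (q ^ nat \<bar>int k - int j\<bar>) * c j) r)
       \<le> ennreal C * (\<Sum>j. epow (c j) r)"
proof
  define W where "W = 2 / (1 - q)"
  have W: "0 < W" using q by (simp add: W_def)
  let ?w = "\<lambda>k j. ennreal (q ^ nat \<bar>int k - int j\<bar>)"
  let ?D = "2 powr r * W powr (r - 1)"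
  show "0 < ?D * W" using W by simp
  fix c :: "nat \<Rightarrow> ennreal"
  have "(\<Sum>k. epow (\<Sum>j. ?w k j * c j) r) \<le> (\<Sum>k. ennreal ?D * (\<Sum>j. ?w k j * epow (c j) r))"
    using suminf_geometric_kernel_le[OF q]
    by (intro suminf_le summableI epow_weighted_suminf_le r W) (auto simp: W_def)
  also have "\<dots> = ennreal ?D * (\<Sum>k. \<Sum>j. ?w k j * epow (c j) r)"
    by simp
  also have "(\<Sum>k. \<Sum>j. ?w k j * epow (c j) r) = (\<Sum>j. \<Sum>k. ?w j k * epow (c j) r)"
    by (subst suminf_swap_ennreal) (simp only: abs_minus_commute)
  also have "\<dots> = (\<Sum>j. (\<Sum>k. ?w j k) * epow (c j) r)"
    by simp
  also have "\<dots> \<le> (\<Sum>j. ennreal W * epow (c j) r)"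
    unfolding W_def by (intro suminf_le summableI mult_right_mono suminf_geometric_kernel_le q) auto
  finally show "(\<Sum>k. epow (\<Sum>j. ?w k j * c j) r) \<le> ennreal (?D * W) * (\<Sum>j. epow (c j) r)"
    using W by (simp add: ennreal_mult mult.assoc mult_left_mono)
qed

subsection \<open>Equivalence of functionals\<close>

lemma le_ennreal_mult_iff:
  assumes "0 < c"
  shows "x \<le> ennreal c * y \<longleftrightarrow> ennreal (1 / c) * x \<le> y"
proof -
  have cancel: "ennreal (1 / c) * (ennreal c * z) = z" "ennreal c * (ennreal (1 / c) * z) = z" for z
    using assms by (simp_all add: mult.assoc[symmetric] ennreal_mult[symmetric])
  show ?thesis
    using mult_left_mono[of x "ennreal c * y" "ennreal (1 / c)"]
      mult_left_mono[of "ennreal (1 / c) * x" y "ennreal c"]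
    by (auto simp: cancel)
qed

text \<open>Both estimates are phrased as upper bounds, so that chaining equivalences only
  multiplies constants.\<close>

lemma equiv_onI:
  assumes "0 < c" "0 < C"
    and "\<And>f. f \<in> F \<Longrightarrow> M f \<le> ennreal c * N f"
    and "\<And>f. f \<in> F \<Longrightarrow> N f \<le> ennreal C * M f"
  shows "equiv_on F N M"
  unfolding equiv_on_def
  by (rule exI[of _ "1 / c"], rule exI[of _ C]) (use assms in \<open>auto simp: le_ennreal_mult_iff\<close>)

lemma equiv_onE:
  assumes "equiv_on F N M"
  obtains c C where "0 < c" "0 < C"
    and "\<And>f. f \<in> F \<Longrightarrow> M f \<le> ennreal c * N f"
    and "\<And>f. f \<in> F \<Longrightarrow> N f \<le> ennreal C * M f"
proof -
  from assms obtain c C where *: "0 < c" "0 < C"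
    "\<And>f. f \<in> F \<Longrightarrow> ennreal c * M f \<le> N f" "\<And>f. f \<in> F \<Longrightarrow> N f \<le> ennreal C * M f"
    unfolding equiv_on_def by blast
  then show ?thesis
    by (intro that[of "1 / c" C]) (auto simp: le_ennreal_mult_iff)
qed

lemma equiv_on_sym: "equiv_on F N M \<Longrightarrow> equiv_on F M N"
proof (elim equiv_onE)
  fix c C :: real
  assume "0 < c" "0 < C" "\<And>f. f \<in> F \<Longrightarrow> M f \<le> ennreal c * N f" "\<And>f. f \<in> F \<Longrightarrow> N f \<le> ennreal C * M f"
  then show "equiv_on F M N" by (intro equiv_onI[of C c])
qed

lemma equiv_on_trans:
  assumes "equiv_on F N M" "equiv_on F M L"
  shows "equiv_on F N L"
proof -
  obtain c C where 1: "0 < c" "0 < C"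
    "\<And>f. f \<in> F \<Longrightarrow> M f \<le> ennreal c * N f" "\<And>f. f \<in> F \<Longrightarrow> N f \<le> ennreal C * M f"
    using assms(1) by (rule equiv_onE) blast
  obtain d D where 2: "0 < d" "0 < D"
    "\<And>f. f \<in> F \<Longrightarrow> L f \<le> ennreal d * M f" "\<And>f. f \<in> F \<Longrightarrow> M f \<le> ennreal D * L f"
    using assms(2) by (rule equiv_onE) blast
  show ?thesis
  proof (rule equiv_onI)
    show "0 < d * c" "0 < C * D" using 1 2 by auto
    fix f assume f: "f \<in> F"
    show "L f \<le> ennreal (d * c) * N f"
      using 1(1) 2(1) order_trans[OF 2(3)[OF f] mult_left_mono[OF 1(3)[OF f]]]
      by (simp add: ennreal_mult mult.assoc)
    show "N f \<le> ennreal (C * D) * L f"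
      using 1(2) 2(2) order_trans[OF 1(4)[OF f] mult_left_mono[OF 2(4)[OF f]]]
      by (simp add: ennreal_mult mult.assoc)
  qed
qed

lemma equiv_on_epow:
  assumes "equiv_on F N M" "0 \<le> a"
  shows "equiv_on F (\<lambda>f. epow (N f) a) (\<lambda>f. epow (M f) a)"
proof -
  obtain c C where 1: "0 < c" "0 < C"
    "\<And>f. f \<in> F \<Longrightarrow> M f \<le> ennreal c * N f" "\<And>f. f \<in> F \<Longrightarrow> N f \<le> ennreal C * M f"
    using assms(1) by (rule equiv_onE) blast
  show ?thesis
  proof (rule equiv_onI)
    show "0 < c powr a" "0 < C powr a" using 1 by auto
    fix f assume f: "f \<in> F"
    show "epow (M f) a \<le> ennreal (c powr a) * epow (N f) a"
      using epow_mono[OF 1(3)[OF f] assms(2)] 1(1) by (simp add: epow_mult epow_ennreal)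
    show "epow (N f) a \<le> ennreal (C powr a) * epow (M f) a"
      using epow_mono[OF 1(4)[OF f] assms(2)] 1(2) by (simp add: epow_mult epow_ennreal)
  qed
qed

subsection \<open>The decreasing rearrangement\<close>

locale unit_domain =
  fixes \<Omega> :: "'a::euclidean_space set"
  assumes lmeasurable_domain: "\<Omega> \<in> sets lebesgue"
    and emeasure_domain: "emeasure lebesgue \<Omega> = 1"
begin

lemma emeasure_lebesgue_on_domain: "emeasure (lebesgue_on \<Omega>) \<Omega> = 1"
  using lmeasurable_domain emeasure_domain by (simp add: emeasure_restrict_space)

lemma superlevel_sets:
  assumes "f \<in> meas_fun \<Omega>"
  shows "{x \<in> \<Omega>. y < \<bar>f x\<bar>} \<in> sets (lebesgue_on \<Omega>)"
proof -
  have [measurable]: "f \<in> borel_measurable (lebesgue_on \<Omega>)"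
    using assms by (simp add: meas_fun_def)
  have "{x \<in> space (lebesgue_on \<Omega>). y < \<bar>f x\<bar>} \<in> sets (lebesgue_on \<Omega>)"
    by measurable
  then show ?thesis by simp
qed

lemma distf_le_1:
  assumes "f \<in> meas_fun \<Omega>"
  shows "distf \<Omega> f y \<le> 1"
  unfolding distf_def emeasure_lebesgue_on_domain[symmetric]
  using lmeasurable_domain by (intro emeasure_mono) (auto simp: sets_restrict_space_iff)

lemma distf_mono:
  assumes "f \<in> meas_fun \<Omega>"
    and "\<And>x. x \<in> \<Omega> \<Longrightarrow> z < \<bar>g x\<bar> \<Longrightarrow> y < \<bar>f x\<bar>"
  shows "distf \<Omega> g z \<le> distf \<Omega> f y"
  unfolding distf_def using assms by (intro emeasure_mono superlevel_sets) auto

text \<open>The superlevel set at \<open>y\<close> is the increasing union of those at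
  \<open>y + 1/(n+1)\<close>. Through this the infimum defining \<open>rearr\<close> is
  attained.\<close>

lemma distf_right_continuous:
  assumes "f \<in> meas_fun \<Omega>" and "\<And>z. y < z \<Longrightarrow> distf \<Omega> f z \<le> c"
  shows "distf \<Omega> f y \<le> c"
proof -
  let ?A = "\<lambda>n. {x \<in> \<Omega>. y + inverse (real (Suc n)) < \<bar>f x\<bar>}"
  have "{x \<in> \<Omega>. y < \<bar>f x\<bar>} = (\<Union>n. ?A n)"
  proof safe
    fix x assume x: "x \<in> \<Omega>" "y < \<bar>f x\<bar>"
    then obtain n where "inverse (real (Suc n)) < \<bar>f x\<bar> - y"
      using reals_Archimedean[of "\<bar>f x\<bar> - y"] by auto
    with x show "x \<in> (\<Union>n. ?A n)" by (auto intro!: exI[of _ n])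
  next
    fix x n assume "y + inverse (real (Suc n)) < \<bar>f x\<bar>"
    moreover have "0 < inverse (real (Suc n))" by simp
    ultimately show "y < \<bar>f x\<bar>" by linarith
  qed
  then have "distf \<Omega> f y = emeasure (lebesgue_on \<Omega>) (\<Union>n. ?A n)"
    by (simp add: distf_def)
  also have "\<dots> = (SUP n. emeasure (lebesgue_on \<Omega>) (?A n))"
  proof (rule SUP_emeasure_incseq[symmetric])
    show "incseq ?A"
    proof (rule incseq_SucI, safe)
      fix n x assume "y + inverse (real (Suc n)) < \<bar>f x\<bar>"
      moreover have "inverse (real (Suc (Suc n))) \<le> inverse (real (Suc n))"
        by (simp add: le_imp_inverse_le)
      ultimately show "y + inverse (real (Suc (Suc n))) < \<bar>f x\<bar>" by linarith
    qed
  qed (use superlevel_sets[OF assms(1)] in auto)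
  also have "\<dots> \<le> c"
    using assms(2) by (intro SUP_least) (simp add: distf_def)
  finally show ?thesis .
qed

text \<open>Superlevel sets of a real-valued function shrink to the empty set, and the measure is
  finite. Hence for \<open>0 < t\<close> the infimum defining \<open>rearr\<close> ranges over a
  nonempty set.\<close>

lemma distf_vanishes:
  assumes "f \<in> meas_fun \<Omega>" "0 < t"
  obtains y where "0 \<le> y" "distf \<Omega> f y \<le> ennreal t"
proof -
  have "(\<lambda>n. distf \<Omega> f (real n)) \<longlonglongrightarrow> emeasure (lebesgue_on \<Omega>) (\<Inter>n. {x \<in> \<Omega>. real n < \<bar>f x\<bar>})"
    unfolding distf_def
  proof (rule Lim_emeasure_decseq)
    show "emeasure (lebesgue_on \<Omega>) {x \<in> \<Omega>. real i < \<bar>f x\<bar>} \<noteq> \<infinity>" for i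
      using distf_le_1[OF assms(1), of "real i"] by (auto simp: distf_def top_unique)
  qed (use superlevel_sets[OF assms(1)] in \<open>auto simp: decseq_def\<close>)
  also have "(\<Inter>n. {x \<in> \<Omega>. real n < \<bar>f x\<bar>}) = {}"
  proof -
    have "\<exists>n. \<not> real n < \<bar>f x\<bar>" for x
      using reals_Archimedean2[of "\<bar>f x\<bar>"] by (auto simp: not_less intro: less_imp_le)
    then show ?thesis by blast
  qed
  finally have "\<forall>\<^sub>F n in sequentially. distf \<Omega> f (real n) < ennreal t"
    using assms(2) by (intro order_tendstoD) auto
  then obtain n where "distf \<Omega> f (real n) < ennreal t"
    by (auto simp: eventually_sequentially)
  then show ?thesis by (intro that[of "real n"]) auto
qed

lemma rearr_nonneg:
  assumes "f \<in> meas_fun \<Omega>" "0 < t"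
  shows "0 \<le> rearr \<Omega> f t"
  unfolding rearr_def
  using distf_vanishes[OF assms] by (intro cInf_greatest) auto

text \<open>The rearrangement is a generalized inverse of the distribution function; this Galois
  correspondence replaces direct work with the infimum from here on.\<close>

lemma rearr_le_iff:
  assumes "f \<in> meas_fun \<Omega>" "0 < t" "0 \<le> y"
  shows "rearr \<Omega> f t \<le> y \<longleftrightarrow> distf \<Omega> f y \<le> ennreal t"
proof
  assume "distf \<Omega> f y \<le> ennreal t"
  then show "rearr \<Omega> f t \<le> y"
    unfolding rearr_def using assms by (intro cInf_lower) (auto intro!: bdd_belowI[of _ 0])
next
  assume le: "rearr \<Omega> f t \<le> y"
  show "distf \<Omega> f y \<le> ennreal t"
  proof (rule distf_right_continuous[OF assms(1)])
    fix z assume "y < z"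
    with le have "rearr \<Omega> f t < z" by simp
    then obtain u where "0 \<le> u" "distf \<Omega> f u \<le> ennreal t" "u < z"
      unfolding rearr_def using distf_vanishes[OF assms(1,2)]
      by (subst (asm) cInf_less_iff) (auto intro!: bdd_belowI[of _ 0])
    moreover have "distf \<Omega> f z \<le> distf \<Omega> f u"
      using \<open>u < z\<close> by (intro distf_mono assms) auto
    ultimately show "distf \<Omega> f z \<le> ennreal t" by simp
  qed
qed

lemma distf_rearr_le:
  assumes "f \<in> meas_fun \<Omega>" "0 < t"
  shows "distf \<Omega> f (rearr \<Omega> f t) \<le> ennreal t"
  using rearr_le_iff[OF assms rearr_nonneg[OF assms]] by simp

lemma rearr_antimono:
  assumes "f \<in> meas_fun \<Omega>" "0 < s" "s \<le> t"
  shows "rearr \<Omega> f t \<le> rearr \<Omega> f s"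
  using assms distf_rearr_le[of f s] rearr_nonneg[of f s]
  by (subst rearr_le_iff) (auto intro: order_trans ennreal_leI)

lemma rearr_mono:
  assumes "f \<in> meas_fun \<Omega>" "g \<in> meas_fun \<Omega>" "0 < t"
    and "\<And>x. x \<in> \<Omega> \<Longrightarrow> \<bar>g x\<bar> \<le> \<bar>f x\<bar>"
  shows "rearr \<Omega> g t \<le> rearr \<Omega> f t"
proof -
  have "distf \<Omega> g (rearr \<Omega> f t) \<le> distf \<Omega> f (rearr \<Omega> f t)"
    using assms by (intro distf_mono) (auto dest: assms(4))
  then show ?thesis
    using assms distf_rearr_le[of f t] rearr_nonneg[of f t]
    by (subst rearr_le_iff) (auto intro: order_trans)
qed

lemma rearr_le_bound:
  assumes "f \<in> meas_fun \<Omega>" "0 < t" "0 \<le> y" "\<And>x. x \<in> \<Omega> \<Longrightarrow> \<bar>f x\<bar> \<le> y"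
  shows "rearr \<Omega> f t \<le> y"
proof -
  have "{x \<in> \<Omega>. y < \<bar>f x\<bar>} = {}"
    using assms(4) by fastforce
  then have "distf \<Omega> f y = 0"
    by (simp only: distf_def emeasure_empty)
  then show ?thesis
    using assms by (subst rearr_le_iff) auto
qed

text \<open>Off the union of the superlevel sets of \<open>g\<close> and \<open>h\<close> at their
  own rearrangement levels, \<open>\<bar>f\<bar>\<close> is at most the sum of the levels, and that
  union has measure at most \<open>s + t\<close>.\<close>

lemma rearr_add_le:
  assumes f: "f \<in> meas_fun \<Omega>" and g: "g \<in> meas_fun \<Omega>" and h: "h \<in> meas_fun \<Omega>"
    and eq: "\<And>x. x \<in> \<Omega> \<Longrightarrow> f x = g x + h x" and "0 < s" "0 < t"
  shows "rearr \<Omega> f (s + t) \<le> rearr \<Omega> g s + rearr \<Omega> h t"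
proof -
  let ?u = "rearr \<Omega> g s" and ?v = "rearr \<Omega> h t"
  have "distf \<Omega> f (?u + ?v) \<le> emeasure (lebesgue_on \<Omega>)
      ({x \<in> \<Omega>. ?u < \<bar>g x\<bar>} \<union> {x \<in> \<Omega>. ?v < \<bar>h x\<bar>})"
    unfolding distf_def
    by (intro emeasure_mono sets.Un superlevel_sets g h) (use eq in fastforce)
  also have "\<dots> \<le> distf \<Omega> g ?u + distf \<Omega> h ?v"
    unfolding distf_def by (intro emeasure_subadditive superlevel_sets g h)
  also have "\<dots> \<le> ennreal s + ennreal t"
    using assms by (intro add_mono distf_rearr_le)
  finally show ?thesis
    using assms rearr_nonneg[OF g \<open>0 < s\<close>] rearr_nonneg[OF h \<open>0 < t\<close>]
    by (subst rearr_le_iff) auto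
qed

lemma borel_measurable_rearr:
  assumes "f \<in> meas_fun \<Omega>"
  shows "rearr \<Omega> f \<in> borel_measurable borel"
proof -
  have "mono_on {0<..} (\<lambda>s. - rearr \<Omega> f s)"
    using assms by (auto intro!: mono_onI rearr_antimono)
  from borel_measurable_uminus[OF borel_measurable_mono_on_fnc[OF this]]
  have 1: "rearr \<Omega> f \<in> borel_measurable (restrict_space borel {s. 0 < s})"
    by (simp add: greaterThan_def)
  \<comment> \<open>Monotonicity is available only for positive arguments; elsewhere
    \<open>ennreal s\<close> is 0, so \<open>rearr\<close> is constant there with its value at
    0.\<close>
  have "(\<lambda>s. if 0 < s then rearr \<Omega> f s else rearr \<Omega> f 0) \<in> borel_measurable borel"
    by (subst measurable_If_restrict_space_iff) (use 1 in auto)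
  also have "(\<lambda>s. if 0 < s then rearr \<Omega> f s else rearr \<Omega> f 0) = rearr \<Omega> f"
    by (auto simp: fun_eq_iff rearr_def ennreal_neg not_less)
  finally show ?thesis .
qed

lemma measurable_rearr_powr:
  assumes "f \<in> meas_fun \<Omega>"
  shows "(\<lambda>s. ennreal (rearr \<Omega> f s powr p)) \<in> borel_measurable borel"
  using borel_measurable_rearr[OF assms] by measurable

text \<open>Equimeasurability: two laws on the line, finite on half-lines \<open>{y<..}\<close>,
  agree if they agree on these. For \<open>0 \<le> y\<close> the rearrangement exceeds
  \<open>y\<close> exactly on the part of the interval below
  \<open>distf \<Omega> f y\<close>.\<close>

lemma distr_rearr:
  assumes f: "f \<in> meas_fun \<Omega>"
  shows "distr (lebesgue_on \<Omega>) borel (\<lambda>x. \<bar>f x\<bar>)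
       = distr (restrict_space lborel {0<..<1}) borel (rearr \<Omega> f)"
proof (rule measure_eqI_lessThan)
  have [measurable]: "f \<in> borel_measurable (lebesgue_on \<Omega>)"
    using f by (simp add: meas_fun_def)
  have [measurable]: "rearr \<Omega> f \<in> borel_measurable (restrict_space lborel {0<..<1})"
    using borel_measurable_rearr[OF f] by (intro measurable_restrict_space1) simp
  have 1: "emeasure (distr (lebesgue_on \<Omega>) borel (\<lambda>x. \<bar>f x\<bar>)) {y<..} = distf \<Omega> f y" for y
    by (subst emeasure_distr) (auto simp: distf_def intro!: arg_cong2[where f = emeasure])
  have 2: "emeasure (distr (restrict_space lborel {0<..<1}) borel (rearr \<Omega> f)) {y<..}
    = emeasure lborel {s \<in> {0<..<1}. y < rearr \<Omega> f s}" for y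
    by (subst emeasure_distr)
      (auto simp: emeasure_restrict_space space_restrict_space intro!: arg_cong2[where f = emeasure])
  show "emeasure (distr (lebesgue_on \<Omega>) borel (\<lambda>x. \<bar>f x\<bar>)) {y<..} < \<infinity>" for y
    unfolding 1 using distf_le_1[OF f, of y] by (auto simp: less_top[symmetric] top_unique)
  fix y :: real
  have "emeasure lborel {s \<in> {0<..<1}. y < rearr \<Omega> f s} = distf \<Omega> f y"
  proof (cases "0 \<le> y")
    case True
    obtain d where d: "0 \<le> d" "distf \<Omega> f y = ennreal d" "d \<le> 1"
      using distf_le_1[OF f, of y] by (cases "distf \<Omega> f y") (auto simp: top_unique)
    have "y < rearr \<Omega> f s \<longleftrightarrow> s < d" if "0 < s" for s
      using rearr_le_iff[OF f that True] d that by (auto simp: not_le[symmetric])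
    then have "{s \<in> {0<..<1}. y < rearr \<Omega> f s} = {0<..<d}"
      using d by auto
    then show ?thesis using d by simp
  next
    case False
    then have "{s \<in> {0<..<1}. y < rearr \<Omega> f s} = {0<..<1}"
      using rearr_nonneg[OF f] by fastforce
    moreover have "{x \<in> \<Omega>. y < \<bar>f x\<bar>} = \<Omega>"
      using False by auto
    ultimately show ?thesis
      by (simp add: distf_def emeasure_lebesgue_on_domain)
  qed
  with 1 2 show "emeasure (distr (lebesgue_on \<Omega>) borel (\<lambda>x. \<bar>f x\<bar>)) {y<..}
    = emeasure (distr (restrict_space lborel {0<..<1}) borel (rearr \<Omega> f)) {y<..}"
    by simp
qed auto

lemma nn_integral_powr_eq_rearr:
  assumes f: "f \<in> meas_fun \<Omega>"
  shows "(\<integral>\<^sup>+ x. ennreal (\<bar>f x\<bar> powr p) \<partial>lebesgue_on \<Omega>)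
       = (\<integral>\<^sup>+ s. indicator {0<..<1} s * ennreal (rearr \<Omega> f s powr p) \<partial>lborel)"
proof -
  have [measurable]: "f \<in> borel_measurable (lebesgue_on \<Omega>)"
    using f by (simp add: meas_fun_def)
  have [measurable]: "rearr \<Omega> f \<in> borel_measurable (restrict_space lborel {0<..<1})"
    using borel_measurable_rearr[OF f] by (intro measurable_restrict_space1) simp
  have "(\<integral>\<^sup>+ x. ennreal (\<bar>f x\<bar> powr p) \<partial>lebesgue_on \<Omega>)
    = (\<integral>\<^sup>+ y. ennreal (y powr p) \<partial>distr (lebesgue_on \<Omega>) borel (\<lambda>x. \<bar>f x\<bar>))"
    by (subst nn_integral_distr) auto
  also have "\<dots> = (\<integral>\<^sup>+ s. ennreal (rearr \<Omega> f s powr p) \<partial>restrict_space lborel {0<..<1})"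
    unfolding distr_rearr[OF f] by (subst nn_integral_distr) auto
  finally show ?thesis
    by (simp add: nn_integral_restrict_space mult.commute)
qed

end

subsection \<open>Dyadic weights and block decompositions of the unit interval\<close>

definition wt :: "real \<Rightarrow> nat \<Rightarrow> ennreal" where
  "wt e k = ennreal (2 powr (e * real k))"

lemma wt_0 [simp]: "wt 0 k = 1"
  by (simp add: wt_def)

lemma wt_mult: "wt d k * wt e k = wt (d + e) k"
  by (simp add: wt_def ennreal_mult[symmetric] powr_add[symmetric] algebra_simps)

lemma wt_mult': "wt d k * (wt e k * x) = wt (d + e) k * x"
  by (simp add: wt_mult mult.assoc[symmetric])

lemma epow_wt: "epow (wt e k) r = wt (e * r) k"
  by (simp add: wt_def epow_ennreal powr_powr mult_ac)

text \<open>The sign condition places \<open>k\<close> on the side of \<open>j\<close> towards which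
  the weight decays, so the ratio of the two weights is exactly
  \<open>2 powr (- \<bar>\<delta>\<bar>)\<close> to the distance of the indices.\<close>

lemma wt_le_kernel:
  assumes "2 powr (- \<bar>\<delta>\<bar>) \<le> q" "\<delta> * (real k - real j) \<le> 0"
  shows "wt \<delta> k \<le> ennreal (q ^ nat \<bar>int k - int j\<bar>) * wt \<delta> j"
proof -
  let ?n = "nat \<bar>int k - int j\<bar>"
  have n: "real ?n = \<bar>real k - real j\<bar>"
    by linarith
  have "\<delta> * (real k - real j) = - (\<bar>\<delta>\<bar> * real ?n)"
    unfolding n abs_mult[symmetric] using assms(2) by simp
  then have "2 powr (\<delta> * real k) = 2 powr (- \<bar>\<delta>\<bar> * real ?n) * 2 powr (\<delta> * real j)"
    unfolding powr_add[symmetric] by (intro arg_cong[where f = "\<lambda>x. 2 powr x"]) (simp add: algebra_simps)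
  also have "2 powr (- \<bar>\<delta>\<bar> * real ?n) = (2 powr (- \<bar>\<delta>\<bar>)) ^ ?n"
    by (simp only: powr_powr[symmetric] powr_realpow[of "2 powr (- \<bar>\<delta>\<bar>)"] powr_gt_zero)
  also have "\<dots> \<le> q ^ ?n"
    using assms(1) by (intro power_mono) auto
  finally have le: "2 powr (\<delta> * real k) \<le> q ^ ?n * 2 powr (\<delta> * real j)"
    by simp
  have "0 \<le> q"
    using assms(1) by (rule order_trans[rotated]) simp
  with le show ?thesis
    by (simp add: wt_def ennreal_mult[symmetric] ennreal_leI)
qed

text \<open>The index sought is the predecessor of the least \<open>n\<close> from \<open>m\<close>
  on with \<open>a n < t\<close>. The start \<open>m\<close> serves intervals \<open>(0, t)\<close>
  that begin inside a later block.\<close>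

lemma between_blocks:
  fixes a :: "nat \<Rightarrow> real"
  assumes "a \<longlonglongrightarrow> 0" "0 < t" "t \<le> a m"
  obtains k where "m \<le> k" "a (Suc k) < t" "t \<le> a k"
proof -
  have "\<forall>\<^sub>F n in sequentially. a n < t"
    using assms by (intro order_tendstoD) auto
  then obtain N where N: "\<And>n. N \<le> n \<Longrightarrow> a n < t"
    by (auto simp: eventually_sequentially)
  define n where "n = (LEAST n. m \<le> n \<and> a n < t)"
  have n: "m \<le> n \<and> a n < t"
    unfolding n_def by (rule LeastI[of _ "max m N"]) (auto intro: N)
  with assms have "n \<noteq> m" by auto
  with n obtain k where k: "n = Suc k" "m \<le> k" by (cases n) auto
  then have "\<not> (m \<le> k \<and> a k < t)"
    unfolding n_def by (intro not_less_Least) simp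
  with k n show ?thesis by (intro that[of k]) auto
qed

text \<open>Only the majorant is integrated term by term, so \<open>g\<close> may be any function;
  the K-functional enters later without a discussion of its measurability in \<open>t\<close>.
  Overlapping endpoints do no harm to an upper bound.\<close>

lemma nn_integral_blocks_le:
  fixes a :: "nat \<Rightarrow> real"
  assumes a: "a 0 = 1" "a \<longlonglongrightarrow> 0" and h[measurable]: "h \<in> borel_measurable borel"
    and g: "\<And>k t. a (Suc k) \<le> t \<Longrightarrow> t \<le> a k \<Longrightarrow> 0 < t \<Longrightarrow> t < 1 \<Longrightarrow> g t \<le> U k * h t"
  shows "(\<integral>\<^sup>+ t. indicator {0<..<1} t * g t \<partial>lborel)
       \<le> (\<Sum>k. U k * (\<integral>\<^sup>+ t. indicator {a (Suc k)..a k} t * h t \<partial>lborel))"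
proof -
  have "indicator {0<..<1} t * g t \<le> (\<Sum>k. U k * (indicator {a (Suc k)..a k} t * h t))" for t
  proof (cases "0 < t \<and> t < 1")
    case True
    obtain k where k: "a (Suc k) < t" "t \<le> a k"
      using between_blocks[of a t 0] True a by auto
    have "indicator {0<..<1} t * g t \<le> U k * (indicator {a (Suc k)..a k} t * h t)"
      using g[of k t] True k by simp
    also have "\<dots> \<le> (\<Sum>k. U k * (indicator {a (Suc k)..a k} t * h t))"
      by (rule le_suminf_ennreal)
    finally show ?thesis .
  qed simp
  then have "(\<integral>\<^sup>+ t. indicator {0<..<1} t * g t \<partial>lborel)
     \<le> (\<integral>\<^sup>+ t. (\<Sum>k. U k * (indicator {a (Suc k)..a k} t * h t)) \<partial>lborel)"
    by (rule nn_integral_mono)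
  also have "\<dots> = (\<Sum>k. U k * (\<integral>\<^sup>+ t. indicator {a (Suc k)..a k} t * h t \<partial>lborel))"
    by (subst nn_integral_suminf) (auto simp: nn_integral_cmult)
  finally show ?thesis .
qed

text \<open>For a lower bound each point may be counted only once, so the closed blocks are first
  replaced by their disjoint interiors, which differ by null sets.\<close>

lemma nn_integral_blocks_ge:
  fixes a :: "nat \<Rightarrow> real"
  assumes a: "a 0 = 1" "decseq a" "\<And>k. 0 < a k" and h[measurable]: "h \<in> borel_measurable borel"
    and g: "\<And>k t. a (Suc k) < t \<Longrightarrow> t < a k \<Longrightarrow> L k * h t \<le> g t"
  shows "(\<Sum>k. L k * (\<integral>\<^sup>+ t. indicator {a (Suc k)..a k} t * h t \<partial>lborel))
       \<le> (\<integral>\<^sup>+ t. indicator {0<..<1} t * g t \<partial>lborel)"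
proof -
  have "(\<integral>\<^sup>+ t. indicator {a (Suc k)..a k} t * h t \<partial>lborel)
      = (\<integral>\<^sup>+ t. indicator {a (Suc k)<..<a k} t * h t \<partial>lborel)" for k
  proof (rule nn_integral_cong_AE)
    show "AE t in lborel. indicator {a (Suc k)..a k} t * h t = indicator {a (Suc k)<..<a k} t * h t"
      using AE_lborel_singleton[of "a k"] AE_lborel_singleton[of "a (Suc k)"]
      by eventually_elim (auto simp: indicator_def)
  qed
  then have "(\<Sum>k. L k * (\<integral>\<^sup>+ t. indicator {a (Suc k)..a k} t * h t \<partial>lborel))
    = (\<integral>\<^sup>+ t. (\<Sum>k. L k * (indicator {a (Suc k)<..<a k} t * h t)) \<partial>lborel)"
    by (subst nn_integral_suminf) (auto simp: nn_integral_cmult)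
  also have "\<dots> \<le> (\<integral>\<^sup>+ t. indicator {0<..<1} t * g t \<partial>lborel)"
  proof (rule nn_integral_mono)
    fix t
    show "(\<Sum>k. L k * (indicator {a (Suc k)<..<a k} t * h t)) \<le> indicator {0<..<1} t * g t"
    proof (cases "\<exists>k. t \<in> {a (Suc k)<..<a k}")
      case True
      then obtain k where k: "t \<in> {a (Suc k)<..<a k}" ..
      have "t \<notin> {a (Suc j)<..<a j}" if "j \<noteq> k" for j
      proof (cases "j < k")
        case True
        then have "a k \<le> a (Suc j)" using a(2) by (intro decseqD[of a]) auto
        with k show ?thesis by auto
      next
        case False
        then have "a j \<le> a (Suc k)" using a(2) that False by (intro decseqD[of a]) auto
        with k show ?thesis by auto
      qed
      then have "(\<Sum>k. L k * (indicator {a (Suc k)<..<a k} t * h t)) = L k * h t"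
        using k by (subst suminf_finite[of "{k}"]) (auto simp: indicator_def)
      moreover have "0 < t" "t < 1"
        using k a(3)[of "Suc k"] decseqD[OF a(2), of 0 k] a(1) by auto
      ultimately show ?thesis using g[of k t] k by simp
    next
      case False
      then have "indicator {a (Suc k)<..<a k} t = (0 :: ennreal)" for k
        by (auto simp: indicator_def)
      then show ?thesis by simp
    qed
  qed
  finally show ?thesis .
qed

lemma nn_integral_inverse_Icc:
  fixes x y :: real
  assumes "0 < x" "x \<le> y"
  shows "(\<integral>\<^sup>+ t. indicator {x..y} t * ennreal (1 / t) \<partial>lborel) = ennreal (ln (y / x))"
proof -
  have "(\<integral>\<^sup>+ t. ennreal (1 / t) * indicator {x..y} t \<partial>lborel) = ennreal (ln y - ln x)"
    using assms
    by (intro nn_integral_FTC_Icc)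
      (auto intro!: derivative_eq_intros simp: has_real_derivative_iff_has_vector_derivative[symmetric])
  then show ?thesis
    using assms by (simp add: ln_div mult.commute)
qed

text \<open>The intervals between consecutive cutoffs are those of case (iii) of the theorem; on the
  \<open>k\<close>-th one \<open>1 - log t\<close> is comparable to \<open>2 ^ k\<close>.\<close>

definition cutoff :: "nat \<Rightarrow> real" where
  "cutoff k = 2 powr (1 - 2 ^ k)"

lemma cutoff_0 [simp]: "cutoff 0 = 1"
  by (simp add: cutoff_def)

lemma cutoff_pos [simp]: "0 < cutoff k"
  by (simp add: cutoff_def)

lemma decseq_cutoff: "decseq cutoff"
  by (auto simp: decseq_def cutoff_def)

lemma cutoff_le_1: "cutoff k \<le> 1"
  using decseqD[OF decseq_cutoff, of 0 k] by simp

lemma cutoff_Suc_less_1: "cutoff (Suc k) < 1"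
proof -
  have "(1::real) < 2 ^ Suc k" by (rule one_less_power) auto
  then show ?thesis by (simp add: cutoff_def powr_less_one)
qed

lemma cutoff_Suc: "cutoff (Suc k) = cutoff k * cutoff k / 2"
  by (simp add: cutoff_def powr_add[symmetric] powr_diff power_add field_simps)

text \<open>Halving a point of a block therefore moves it at most into the next block, which is what
  the dilation in the subadditivity of rearrangements requires.\<close>

lemma cutoff_Suc_le: "cutoff (Suc k) \<le> cutoff k / 2"
  using mult_left_mono[OF cutoff_le_1[of k], of "cutoff k"] by (simp add: cutoff_Suc less_imp_le)

lemma cutoff_tendsto: "cutoff \<longlonglongrightarrow> 0"
proof (rule tendsto_sandwich[of "\<lambda>_. 0" cutoff _ "\<lambda>k. (1/2) ^ k"])
  have "cutoff k \<le> (1/2) ^ k" for k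
  proof (induction k)
    case (Suc k)
    then show ?case using cutoff_Suc_le[of k] by simp
  qed simp
  then show "\<forall>\<^sub>F k in sequentially. cutoff k \<le> (1/2) ^ k"
    by simp
  show "(\<lambda>k. (1/2) ^ k :: real) \<longlonglongrightarrow> 0"
    by (rule LIMSEQ_power_zero) simp
qed (auto intro!: always_eventually less_imp_le)

lemma ln_cutoff_ratio: "ln (cutoff k / cutoff (Suc k)) = 2 ^ k * ln 2"
  by (simp add: cutoff_def powr_diff[symmetric] ln_powr)

lemma powr_le_2_powr_abs:
  fixes x :: real
  assumes "1 / 2 \<le> x" "x \<le> 2"
  shows "x powr e \<le> 2 powr \<bar>e\<bar>"
proof (cases "0 \<le> e")
  case True
  then show ?thesis using assms by (auto intro: powr_mono2)
next
  case False
  then have "x powr e \<le> (1 / 2) powr e"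
    using assms by (intro powr_mono2') auto
  also have "\<dots> = 2 powr \<bar>e\<bar>"
    using False by (simp add: powr_divide powr_minus_divide)
  finally show ?thesis .
qed

lemma log_weight_block:
  assumes "cutoff (Suc k) \<le> t" "t \<le> cutoff k"
  shows "ennreal ((1 - ln t) powr e) \<le> ennreal (2 powr \<bar>e\<bar>) * wt e k"
    and "wt e k \<le> ennreal (2 powr \<bar>e\<bar>) * ennreal ((1 - ln t) powr e)"
proof -
  have t: "0 < t" using assms(1) cutoff_pos[of "Suc k"] by linarith
  have ln_cutoff: "ln (cutoff j) = (1 - 2 ^ j) * ln 2" for j
    by (simp add: cutoff_def ln_powr)
  have ln2: "1 / 2 \<le> ln (2::real)" "ln (2::real) \<le> 1"
    using ln2_ge_two_thirds ln_2_less_1 by linarith+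
  have "ln t \<le> (1 - 2 ^ k) * ln 2" "(1 - 2 ^ Suc k) * ln 2 \<le> ln t"
    using assms t unfolding ln_cutoff[symmetric] by (simp_all add: ln_mono)
  moreover have "(2 ^ k - 1) * (1/2) \<le> (2 ^ k - 1) * ln (2::real)"
    "(2 ^ Suc k - 1) * ln (2::real) \<le> (2 ^ Suc k - 1) * 1"
    using ln2 one_le_power[of "2::real" k] one_le_power[of "2::real" "Suc k"]
    by (intro mult_left_mono; linarith)+
  \<comment> \<open>As \<open>ln 2\<close> lies between 1/2 and 1, the quantity
    \<open>1 - ln t\<close> is at least \<open>1 + (2 ^ k - 1) / 2\<close> and at most
    \<open>1 + (2 ^ Suc k - 1)\<close>.\<close>
  ultimately have b: "2 ^ k / 2 \<le> 1 - ln t" "1 - ln t \<le> 2 * 2 ^ k"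
    by (simp_all add: field_simps)
  have "0 < 1 - ln t"
    using b(1) by (rule less_le_trans[rotated]) simp
  define x where "x = (1 - ln t) / 2 ^ k"
  have x: "1 / 2 \<le> x" "x \<le> 2" "0 < x" "1 - ln t = x * 2 ^ k"
    using b \<open>0 < 1 - ln t\<close> by (auto simp: x_def field_simps)
  have eq: "(1 - ln t) powr e = x powr e * 2 powr (e * real k)"
    using x by (simp add: powr_mult powr_realpow[symmetric] powr_powr mult.commute)
  show "ennreal ((1 - ln t) powr e) \<le> ennreal (2 powr \<bar>e\<bar>) * wt e k"
    unfolding eq wt_def using powr_le_2_powr_abs[OF x(1,2)]
    by (simp add: ennreal_mult[symmetric] ennreal_leI)
  have "1 / 2 \<le> 1 / x" "1 / x \<le> 2"
    using x by (auto simp: field_simps)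
  from powr_le_2_powr_abs[OF this, of e] have "1 \<le> 2 powr \<bar>e\<bar> * x powr e"
    using x by (simp add: powr_divide field_simps)
  from mult_right_mono[OF this, of "2 powr (e * real k)"]
  show "wt e k \<le> ennreal (2 powr \<bar>e\<bar>) * ennreal ((1 - ln t) powr e)"
    unfolding eq wt_def by (simp add: ennreal_mult[symmetric] ennreal_leI mult.assoc)
qed

text \<open>The r-th power of the integral norms of cases (i) and (ii), with \<open>\<delta>\<close>
  standing for \<open>\<theta> - 1/p\<close>. Splitting off \<open>1/r\<close> makes
  \<open>\<delta>\<close> the exponent of the discrete weight.\<close>

definition log_functional :: "real \<Rightarrow> real \<Rightarrow> (real \<Rightarrow> ennreal) \<Rightarrow> ennreal" where
  "log_functional \<delta> r X = (\<integral>\<^sup>+ t. indicator {0<..<1} t *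
     (epow (ennreal ((1 - ln t) powr (\<delta> - 1/r)) * X t) r / ennreal t) \<partial>lborel)"

lemma divide_ennreal_eq: "0 < t \<Longrightarrow> x / ennreal t = x * ennreal (1 / t)"
  by (simp add: divide_ennreal_def inverse_ennreal inverse_eq_divide[of t])

lemma log_functional_integrand:
  assumes "0 < t" "0 < r"
  shows "epow (ennreal ((1 - ln t) powr (\<delta> - 1/r)) * x) r / ennreal t
    = ennreal ((1 - ln t) powr (\<delta> * r - 1)) * epow x r * ennreal (1 / t)"
proof -
  have "(\<delta> - 1 / r) * r = \<delta> * r - 1" using assms by (simp add: field_simps)
  then show ?thesis
    using assms by (simp add: epow_mult epow_ennreal powr_powr divide_ennreal_eq)
qed

text \<open>The mass \<open>2 ^ k * ln 2\<close> of the block for dt/t raises the weight exponent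
  from \<open>\<delta> * r - 1\<close> to \<open>\<delta> * r\<close>.\<close>

lemma log_weight_integral:
  "wt (\<delta> * r - 1) k * epow x r * (\<integral>\<^sup>+ t. indicator {cutoff (Suc k)..cutoff k} t * ennreal (1 / t) \<partial>lborel)
    = ennreal (ln 2) * epow (wt \<delta> k * x) r"
proof -
  have "(\<integral>\<^sup>+ t. indicator {cutoff (Suc k)..cutoff k} t * ennreal (1 / t) \<partial>lborel) = wt 1 k * ennreal (ln 2)"
    by (subst nn_integral_inverse_Icc)
      (auto simp: ln_cutoff_ratio decseqD[OF decseq_cutoff, of k "Suc k"] wt_def powr_realpow ennreal_mult)
  then have "wt (\<delta> * r - 1) k * epow x r * (\<integral>\<^sup>+ t. indicator {cutoff (Suc k)..cutoff k} t * ennreal (1 / t) \<partial>lborel)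
    = ennreal (ln 2) * ((wt (\<delta> * r - 1) k * wt 1 k) * epow x r)"
    by (simp add: mult_ac)
  then show ?thesis
    by (simp add: wt_mult epow_mult epow_wt)
qed

lemma log_functional_le:
  assumes "0 < r" "\<And>k t. cutoff (Suc k) \<le> t \<Longrightarrow> t \<le> cutoff k \<Longrightarrow> X t \<le> U k"
  shows "log_functional \<delta> r X \<le> ennreal (2 powr \<bar>\<delta> * r - 1\<bar>) * (\<Sum>k. epow (wt \<delta> k * U k) r)"
proof -
  let ?c = "ennreal (2 powr \<bar>\<delta> * r - 1\<bar>)"
  have "log_functional \<delta> r X \<le> (\<Sum>k. (?c * (wt (\<delta> * r - 1) k * epow (U k) r)) *
      (\<integral>\<^sup>+ t. indicator {cutoff (Suc k)..cutoff k} t * ennreal (1 / t) \<partial>lborel))"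
    unfolding log_functional_def
  proof (intro nn_integral_blocks_le cutoff_tendsto cutoff_0)
    fix k and t :: real assume t: "cutoff (Suc k) \<le> t" "t \<le> cutoff k" "0 < t"
    have "ennreal ((1 - ln t) powr (\<delta> * r - 1)) * epow (X t) r
      \<le> (?c * wt (\<delta> * r - 1) k) * epow (U k) r"
      using assms t by (intro mult_mono log_weight_block epow_mono) auto
    then show "epow (ennreal ((1 - ln t) powr (\<delta> - 1/r)) * X t) r / ennreal t
      \<le> ?c * (wt (\<delta> * r - 1) k * epow (U k) r) * ennreal (1 / t)"
      unfolding log_functional_integrand[OF t(3) assms(1)] mult.assoc[symmetric]
      by (rule mult_right_mono) simp
  qed simp
  also have "\<dots> = ?c * (ennreal (ln 2) * (\<Sum>k. epow (wt \<delta> k * U k) r))"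
    by (simp only: mult.assoc[of ?c] log_weight_integral ennreal_suminf_cmult)
  also have "\<dots> \<le> ?c * (ennreal 1 * (\<Sum>k. epow (wt \<delta> k * U k) r))"
    using ln_2_less_1 by (intro mult_left_mono mult_right_mono ennreal_leI) auto
  finally show ?thesis by simp
qed

lemma log_functional_ge:
  assumes "0 < r" "\<And>k t. cutoff (Suc k) \<le> t \<Longrightarrow> t \<le> cutoff k \<Longrightarrow> L k \<le> X t"
  shows "(\<Sum>k. epow (wt \<delta> k * L k) r) \<le> ennreal (2 * 2 powr \<bar>\<delta> * r - 1\<bar>) * log_functional \<delta> r X"
proof -
  define b where "b = 2 powr \<bar>\<delta> * r - 1\<bar>"
  let ?S = "\<Sum>k. epow (wt \<delta> k * L k) r"
  have b: "0 < b" by (simp add: b_def)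
  have "ennreal (1 / b) * (ennreal (ln 2) * ?S) = (\<Sum>k. (ennreal (1 / b) * (wt (\<delta> * r - 1) k * epow (L k) r)) *
      (\<integral>\<^sup>+ t. indicator {cutoff (Suc k)..cutoff k} t * ennreal (1 / t) \<partial>lborel))"
    by (simp only: mult.assoc[of "ennreal (1 / b)"] log_weight_integral ennreal_suminf_cmult)
  also have "\<dots> \<le> log_functional \<delta> r X"
    unfolding log_functional_def
  proof (intro nn_integral_blocks_ge cutoff_pos cutoff_0 decseq_cutoff)
    fix k and t :: real assume t: "cutoff (Suc k) < t" "t < cutoff k"
    then have t0: "0 < t" using cutoff_pos[of "Suc k"] by linarith
    have "ennreal (1 / b) * wt (\<delta> * r - 1) k \<le> ennreal ((1 - ln t) powr (\<delta> * r - 1))"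
      using log_weight_block(2)[of k t] t b by (simp add: b_def le_ennreal_mult_iff)
    then have "(ennreal (1 / b) * wt (\<delta> * r - 1) k) * epow (L k) r
      \<le> ennreal ((1 - ln t) powr (\<delta> * r - 1)) * epow (X t) r"
      using assms t by (intro mult_mono epow_mono) auto
    then show "ennreal (1 / b) * (wt (\<delta> * r - 1) k * epow (L k) r) * ennreal (1 / t)
      \<le> epow (ennreal ((1 - ln t) powr (\<delta> - 1/r)) * X t) r / ennreal t"
      unfolding log_functional_integrand[OF t0 assms(1)] mult.assoc[symmetric]
      by (rule mult_right_mono) simp
  qed simp
  finally have *: "ennreal (ln 2) * ?S \<le> ennreal b * log_functional \<delta> r X"
    using b by (simp add: le_ennreal_mult_iff)
  have "ennreal (1 / 2) * ?S \<le> ennreal (ln 2) * ?S"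
    using ln2_ge_two_thirds by (intro mult_right_mono ennreal_leI) auto
  also note *
  finally have "?S \<le> ennreal 2 * (ennreal b * log_functional \<delta> r X)"
    by (subst le_ennreal_mult_iff) auto
  then show ?thesis
    using b by (simp add: b_def ennreal_mult mult.assoc)
qed

subsection \<open>Block norms of the rearrangement\<close>

lemma rint_mono: "A \<subseteq> B \<Longrightarrow> rint \<Omega> p f A \<le> rint \<Omega> p f B"
  unfolding rint_def by (intro nn_integral_mono mult_right_mono) (auto simp: indicator_def)

text \<open>The sign condition selects the sums over \<open>j \<le> k\<close> when
  \<open>\<delta> < 0\<close> and the tails \<open>j \<ge> k\<close> when
  \<open>\<delta> > 0\<close>. In both cases the weight at \<open>k\<close> is a geometric kernel
  times the weight at \<open>j\<close>, so the Schur test applies.\<close>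

lemma hardy_discrete:
  assumes r: "1 \<le> r" and \<delta>: "\<delta> \<noteq> 0"
  obtains C where "0 < C" "\<And>c :: nat \<Rightarrow> ennreal.
    (\<Sum>k. epow (wt \<delta> k * (\<Sum>j. if \<delta> * (real k - real j) \<le> 0 then c j else 0)) r)
      \<le> ennreal C * (\<Sum>k. epow (wt \<delta> k * c k) r)"
proof -
  define q where "q = 2 powr (- \<bar>\<delta>\<bar>)"
  have q: "0 < q" "q < 1"
    using \<delta> powr_less_mono[of "- \<bar>\<delta>\<bar>" 0 2] by (auto simp: q_def)
  obtain C where C: "0 < C"
    "\<And>c :: nat \<Rightarrow> ennreal. (\<Sum>k. epow (\<Sum>j. ennreal (q ^ nat \<bar>int k - int j\<bar>) * c j) r)
       \<le> ennreal C * (\<Sum>j. epow (c j) r)"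
    using schur_geometric[OF q r] by blast
  show ?thesis
  proof (rule that[OF C(1)])
    fix c :: "nat \<Rightarrow> ennreal"
    have "wt \<delta> k * (\<Sum>j. if \<delta> * (real k - real j) \<le> 0 then c j else 0)
      \<le> (\<Sum>j. ennreal (q ^ nat \<bar>int k - int j\<bar>) * (wt \<delta> j * c j))" for k
      unfolding ennreal_suminf_cmult[symmetric]
      by (intro suminf_le summableI)
        (auto simp: mult.assoc[symmetric] q_def intro!: mult_right_mono wt_le_kernel)
    then have "(\<Sum>k. epow (wt \<delta> k * (\<Sum>j. if \<delta> * (real k - real j) \<le> 0 then c j else 0)) r)
      \<le> (\<Sum>k. epow (\<Sum>j. ennreal (q ^ nat \<bar>int k - int j\<bar>) * (wt \<delta> j * c j)) r)"
      using r by (intro suminf_le summableI epow_mono) auto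
    also note C(2)
    finally show "(\<Sum>k. epow (wt \<delta> k * (\<Sum>j. if \<delta> * (real k - real j) \<le> 0 then c j else 0)) r)
      \<le> ennreal C * (\<Sum>k. epow (wt \<delta> k * c k) r)" .
  qed
qed

lemma suminf_head_le: "x 0 \<le> y \<Longrightarrow> (\<Sum>k. x (Suc k)) \<le> z \<Longrightarrow> (\<Sum>k. x k :: ennreal) \<le> y + z"
  by (subst suminf_offset[of _ 1]) (auto simp: add.commute intro: summableI add_mono)

locale grand_small = unit_domain +
  fixes p :: real
  assumes p_gt_1: "1 < p"
begin

definition blk :: "('a \<Rightarrow> real) \<Rightarrow> nat \<Rightarrow> ennreal" where
  "blk f k = epow (rint \<Omega> p f {cutoff (Suc k)..cutoff k}) (1/p)"

definition block_sum :: "real \<Rightarrow> real \<Rightarrow> ('a \<Rightarrow> real) \<Rightarrow> ennreal" where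
  "block_sum \<delta> r f = (\<Sum>k. epow (wt \<delta> k * blk f k) r)"

lemma epow_blk: "epow (blk f k) p = rint \<Omega> p f {cutoff (Suc k)..cutoff k}"
  using p_gt_1 by (simp add: blk_def epow_epow)

lemma blk_le: "{cutoff (Suc k)..cutoff k} \<subseteq> A \<Longrightarrow> blk f k \<le> epow (rint \<Omega> p f A) (1/p)"
  using p_gt_1 by (auto simp: blk_def intro!: epow_mono rint_mono)

text \<open>The blocks exhaust the unit interval except for the point 0, which is a null set and is
  therefore allowed in \<open>A\<close> separately.\<close>

lemma rint_le_blocks:
  assumes f: "f \<in> meas_fun \<Omega>" and A: "A \<subseteq> {0} \<union> (\<Union>j\<in>J. {cutoff (Suc j)..cutoff j})"
  shows "rint \<Omega> p f A \<le> (\<Sum>j. if j \<in> J then rint \<Omega> p f {cutoff (Suc j)..cutoff j} else 0)"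
proof -
  note [measurable] = measurable_rearr_powr[OF f, of p]
  let ?h = "\<lambda>s. ennreal (rearr \<Omega> f s powr p)"
  let ?T = "\<lambda>j. if j \<in> J then {cutoff (Suc j)..cutoff j} else {}"
  have *: "indicator A s * ?h s \<le> (\<Sum>j. indicator (?T j) s * ?h s)" if "s \<noteq> 0" for s
  proof (cases "s \<in> A")
    case True
    with A that obtain j where j: "j \<in> J" "s \<in> {cutoff (Suc j)..cutoff j}" by auto
    then have "indicator A s * ?h s \<le> indicator (?T j) s * ?h s"
      using True by simp
    also have "\<dots> \<le> (\<Sum>j. indicator (?T j) s * ?h s)"
      by (rule le_suminf_ennreal)
    finally show ?thesis .
  qed simp
  have "rint \<Omega> p f A \<le> (\<integral>\<^sup>+ s. (\<Sum>j. indicator (?T j) s * ?h s) \<partial>lborel)"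
    unfolding rint_def
    by (intro nn_integral_mono_AE eventually_mono[OF AE_lborel_singleton[of 0]]) (rule *)
  also have "\<dots> = (\<Sum>j. \<integral>\<^sup>+ s. indicator (?T j) s * ?h s \<partial>lborel)"
    by (rule nn_integral_suminf) simp
  also have "\<dots> = (\<Sum>j. if j \<in> J then rint \<Omega> p f {cutoff (Suc j)..cutoff j} else 0)"
    by (intro suminf_cong) (simp add: rint_def)
  finally show ?thesis .
qed

lemma epow_rint_le_blocks:
  assumes f: "f \<in> meas_fun \<Omega>" and A: "A \<subseteq> {0} \<union> (\<Union>j\<in>J. {cutoff (Suc j)..cutoff j})"
  shows "epow (rint \<Omega> p f A) (1/p) \<le> (\<Sum>j. if j \<in> J then blk f j else 0)"
proof -
  have "epow (rint \<Omega> p f A) (1/p)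
    \<le> epow (\<Sum>j. if j \<in> J then rint \<Omega> p f {cutoff (Suc j)..cutoff j} else 0) (1/p)"
    using p_gt_1 by (intro epow_mono rint_le_blocks assms) auto
  also have "\<dots> \<le> (\<Sum>j. epow (if j \<in> J then rint \<Omega> p f {cutoff (Suc j)..cutoff j} else 0) (1/p))"
    using p_gt_1 by (intro epow_suminf_le) auto
  also have "\<dots> = (\<Sum>j. if j \<in> J then blk f j else 0)"
    by (intro suminf_cong) (simp add: blk_def)
  finally show ?thesis .
qed

lemma upper_interval_blocks:
  assumes "cutoff (Suc k) \<le> t"
  shows "{t..1} \<subseteq> {0} \<union> (\<Union>j\<in>{..k}. {cutoff (Suc j)..cutoff j})"
proof
  fix s assume s: "s \<in> {t..1}"
  show "s \<in> {0} \<union> (\<Union>j\<in>{..k}. {cutoff (Suc j)..cutoff j})"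
  \<comment> \<open>The search below returns half-open blocks and would put this left endpoint into
    block \<open>k + 1\<close>, outside the index set.\<close>
  proof (cases "s = cutoff (Suc k)")
    case True
    then show ?thesis using decseqD[OF decseq_cutoff, of k "Suc k"] by auto
  next
    case False
    with s assms have *: "cutoff (Suc k) < s" by auto
    then have "0 < s" using cutoff_pos[of "Suc k"] by linarith
    then obtain j where j: "cutoff (Suc j) < s" "s \<le> cutoff j"
      using between_blocks[OF cutoff_tendsto, of s 0] s by auto
    have "j \<le> k"
    proof (rule ccontr)
      assume "\<not> j \<le> k"
      then have "cutoff j \<le> cutoff (Suc k)" by (intro decseqD[OF decseq_cutoff]) auto
      with * j show False by simp
    qed
    with j show ?thesis by auto
  qed
qed

lemma lower_interval_blocks:
  assumes "t \<le> cutoff k"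
  shows "{0..t} \<subseteq> {0} \<union> (\<Union>j\<in>{k..}. {cutoff (Suc j)..cutoff j})"
proof
  fix s assume s: "s \<in> {0..t}"
  show "s \<in> {0} \<union> (\<Union>j\<in>{k..}. {cutoff (Suc j)..cutoff j})"
  proof (cases "s = 0")
    case False
    with s assms obtain j where "k \<le> j" "cutoff (Suc j) < s" "s \<le> cutoff j"
      using between_blocks[OF cutoff_tendsto, of s k] by auto
    then show ?thesis by auto
  qed simp
qed

lemma equiv_upper_integral:
  assumes \<delta>: "\<delta> < 0" and r: "1 \<le> r"
  shows "equiv_on (meas_fun \<Omega>) (\<lambda>f. log_functional \<delta> r (\<lambda>t. epow (rint \<Omega> p f {t..1}) (1/p)))
           (block_sum \<delta> r)"
proof -
  obtain C where C: "0 < C" "\<And>c :: nat \<Rightarrow> ennreal.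
    (\<Sum>k. epow (wt \<delta> k * (\<Sum>j. if \<delta> * (real k - real j) \<le> 0 then c j else 0)) r)
      \<le> ennreal C * (\<Sum>k. epow (wt \<delta> k * c k) r)"
    using hardy_discrete[OF r, of \<delta>] \<delta> by blast
  let ?E = "2 powr \<bar>\<delta> * r - 1\<bar>" and ?\<Phi> = "\<lambda>f. log_functional \<delta> r (\<lambda>t. epow (rint \<Omega> p f {t..1}) (1/p))"
  show ?thesis
  proof (rule equiv_onI)
    show "0 < 2 powr (- \<delta> * r) * (2 * ?E)" "0 < ?E * C" using C by auto
    fix f assume f: "f \<in> meas_fun \<Omega>"
    have "?\<Phi> f \<le> ennreal ?E * (\<Sum>k. epow (wt \<delta> k * (\<Sum>j. if j \<in> {..k} then blk f j else 0)) r)"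
      using r f by (intro log_functional_le epow_rint_le_blocks upper_interval_blocks) auto
    also have "\<dots> \<le> ennreal ?E * (ennreal C * block_sum \<delta> r f)"
    proof -
      have "\<delta> * (real k - real j) \<le> 0 \<longleftrightarrow> j \<in> {..k}" for j k
        using \<delta> by (auto simp: mult_le_0_iff)
      with C(2)[of "blk f"] show ?thesis
        unfolding block_sum_def by (intro mult_left_mono) auto
    qed
    finally show "?\<Phi> f \<le> ennreal (?E * C) * block_sum \<delta> r f"
      using C by (simp add: ennreal_mult mult.assoc)
    \<comment> \<open>For \<open>t\<close> in block \<open>k\<close> the interval
      \<open>[t, 1]\<close> is only sure to contain the blocks before \<open>k\<close>. The shift by
      one index costs the factor \<open>2 powr (- \<delta> * r)\<close>.\<close>
    let ?L = "\<lambda>k. case k of 0 \<Rightarrow> 0 | Suc j \<Rightarrow> blk f j"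
    have *: "(\<Sum>k. epow (wt \<delta> k * ?L k) r) \<le> ennreal (2 * ?E) * ?\<Phi> f"
    proof (rule log_functional_ge)
      fix k and t :: real assume t: "cutoff (Suc k) \<le> t" "t \<le> cutoff k"
      show "?L k \<le> epow (rint \<Omega> p f {t..1}) (1/p)"
      proof (cases k)
        case (Suc j)
        then have "{cutoff (Suc j)..cutoff j} \<subseteq> {t..1}"
          using t cutoff_le_1[of j] by auto
        then show ?thesis using Suc by (auto intro: blk_le)
      qed simp
    qed (use r in auto)
    have "epow (wt \<delta> k * blk f k) r = ennreal (2 powr (- \<delta> * r)) * epow (wt \<delta> (Suc k) * blk f k) r" for k
    proof -
      have "wt (\<delta> * r) k = ennreal (2 powr (- \<delta> * r)) * wt (\<delta> * r) (Suc k)"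
        by (simp add: wt_def ennreal_mult[symmetric] powr_add[symmetric] algebra_simps)
      then show ?thesis by (simp add: epow_mult epow_wt mult.assoc)
    qed
    then have "block_sum \<delta> r f = ennreal (2 powr (- \<delta> * r)) * (\<Sum>k. epow (wt \<delta> (Suc k) * ?L (Suc k)) r)"
      unfolding block_sum_def by simp
    also have "(\<Sum>k. epow (wt \<delta> (Suc k) * ?L (Suc k)) r) = (\<Sum>k. epow (wt \<delta> k * ?L k) r)"
      by (subst (2) suminf_offset[of _ 1]) (auto intro: summableI)
    also note mult_left_mono[OF *, of "ennreal (2 powr (- \<delta> * r))"]
    finally show "block_sum \<delta> r f \<le> ennreal (2 powr (- \<delta> * r) * (2 * ?E)) * ?\<Phi> f"
      by (simp add: ennreal_mult mult.assoc)
  qed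
qed

text \<open>The block next to \<open>t = 1\<close> is not contained in any \<open>(0, t)\<close>; monotonicity of the
  rearrangement controls it by the other half of the interval.\<close>

lemma blk_0_le:
  assumes f: "f \<in> meas_fun \<Omega>"
  shows "blk f 0 \<le> epow (rint \<Omega> p f {0..1/2}) (1/p)"
  unfolding blk_def
proof (intro epow_mono)
  have half: "cutoff (Suc 0) = 1/2" by (simp add: cutoff_def powr_minus_divide)
  note [measurable] = measurable_rearr_powr[OF f, of p]
  let ?h = "\<lambda>s. ennreal (rearr \<Omega> f s powr p)"
  have "rint \<Omega> p f {cutoff (Suc 0)..cutoff 0} = (\<integral>\<^sup>+ s. indicator {1/2..1} s * ?h s \<partial>lborel)"
    unfolding half by (simp add: rint_def)
  also have "\<dots> = (\<integral>\<^sup>+ s. indicator {1/2..1} (1/2 + s) * ?h (1/2 + s) \<partial>lborel)"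
    using nn_integral_real_affine[of "\<lambda>s. indicator {1/2..1} s * ?h s" 1 "1/2"] by simp
  also have "\<dots> \<le> (\<integral>\<^sup>+ s. indicator {0..1/2} s * ?h s \<partial>lborel)"
  proof (intro nn_integral_mono_AE eventually_mono[OF AE_lborel_singleton[of 0]])
    fix s :: real assume "s \<noteq> 0"
    show "indicator {1/2..1} (1/2 + s) * ?h (1/2 + s) \<le> indicator {0..1/2} s * ?h s"
    proof (cases "0 < s \<and> s \<le> 1/2")
      case True
      then have "?h (1/2 + s) \<le> ?h s"
        using f p_gt_1 by (intro ennreal_leI powr_mono2 rearr_antimono rearr_nonneg) auto
      with True show ?thesis by (simp add: indicator_def)
    qed (use \<open>s \<noteq> 0\<close> in \<open>auto simp: indicator_def\<close>)
  qed
  finally show "rint \<Omega> p f {cutoff (Suc 0)..cutoff 0} \<le> rint \<Omega> p f {0..1/2}"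
    by (simp add: rint_def)
qed (use p_gt_1 in auto)

lemma equiv_lower_integral:
  assumes \<delta>: "0 < \<delta>" and r: "1 \<le> r"
  shows "equiv_on (meas_fun \<Omega>) (\<lambda>f. log_functional \<delta> r (\<lambda>t. epow (rint \<Omega> p f {0..t}) (1/p)))
           (block_sum \<delta> r)"
proof -
  obtain C where C: "0 < C" "\<And>c :: nat \<Rightarrow> ennreal.
    (\<Sum>k. epow (wt \<delta> k * (\<Sum>j. if \<delta> * (real k - real j) \<le> 0 then c j else 0)) r)
      \<le> ennreal C * (\<Sum>k. epow (wt \<delta> k * c k) r)"
    using hardy_discrete[OF r, of \<delta>] \<delta> by blast
  let ?E = "2 powr \<bar>\<delta> * r - 1\<bar>" and ?\<Phi> = "\<lambda>f. log_functional \<delta> r (\<lambda>t. epow (rint \<Omega> p f {0..t}) (1/p))"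
  show ?thesis
  proof (rule equiv_onI)
    show "0 < (1 + 2 powr (\<delta> * r)) * (2 * ?E)" "0 < ?E * C"
      using C by (auto intro!: mult_pos_pos add_pos_pos)
    fix f assume f: "f \<in> meas_fun \<Omega>"
    have "?\<Phi> f \<le> ennreal ?E * (\<Sum>k. epow (wt \<delta> k * (\<Sum>j. if j \<in> {k..} then blk f j else 0)) r)"
      using r f by (intro log_functional_le epow_rint_le_blocks lower_interval_blocks) auto
    also have "\<dots> \<le> ennreal ?E * (ennreal C * block_sum \<delta> r f)"
    proof -
      have "\<delta> * (real k - real j) \<le> 0 \<longleftrightarrow> j \<in> {k..}" for j k
        using \<delta> by (auto simp: mult_le_0_iff)
      with C(2)[of "blk f"] show ?thesis
        unfolding block_sum_def by (intro mult_left_mono) auto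
    qed
    finally show "?\<Phi> f \<le> ennreal (?E * C) * block_sum \<delta> r f"
      using C by (simp add: ennreal_mult mult.assoc)
    \<comment> \<open>For \<open>t\<close> in block \<open>k\<close> the interval
      \<open>[0, t]\<close> is only sure to contain the blocks after \<open>k\<close>, hence the
      shift. Index 0 also carries block 0, which no shifted index reaches.\<close>
    let ?L = "\<lambda>k. case k of 0 \<Rightarrow> max (blk f 0) (blk f 1) | Suc j \<Rightarrow> blk f (Suc (Suc j))"
    let ?S = "\<Sum>k. epow (wt \<delta> k * ?L k) r"
    have *: "?S \<le> ennreal (2 * ?E) * ?\<Phi> f"
    proof (rule log_functional_ge)
      fix k and t :: real assume t: "cutoff (Suc k) \<le> t" "t \<le> cutoff k"
      have le: "blk f (Suc k) \<le> epow (rint \<Omega> p f {0..t}) (1/p)"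
        using t less_imp_le[OF cutoff_pos[of "Suc (Suc k)"]] by (intro blk_le) auto
      show "?L k \<le> epow (rint \<Omega> p f {0..t}) (1/p)"
      proof (cases k)
        case 0
        have "rint \<Omega> p f {0..1/2} \<le> rint \<Omega> p f {0..t}"
          using t 0 by (intro rint_mono) (auto simp: cutoff_def powr_minus_divide)
        then have "epow (rint \<Omega> p f {0..1/2}) (1/p) \<le> epow (rint \<Omega> p f {0..t}) (1/p)"
          using p_gt_1 by (intro epow_mono) auto
        with blk_0_le[OF f] le 0 show ?thesis by auto
      qed (use le in auto)
    qed (use r in auto)
    have "block_sum \<delta> r f \<le> ?S + ennreal (2 powr (\<delta> * r)) * ?S"
      unfolding block_sum_def
    proof (rule suminf_head_le)
      have "epow (wt \<delta> 0 * blk f 0) r \<le> epow (wt \<delta> 0 * ?L 0) r"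
        using r by (intro epow_mono mult_left_mono) auto
      also have "\<dots> \<le> ?S"
        by (rule le_suminf_ennreal)
      finally show "epow (wt \<delta> 0 * blk f 0) r \<le> ?S" .
      have "epow (wt \<delta> (Suc k) * blk f (Suc k)) r
        \<le> ennreal (2 powr (\<delta> * r)) * epow (wt \<delta> k * ?L k) r" for k
      proof -
        have "wt (\<delta> * r) (Suc k) = ennreal (2 powr (\<delta> * r)) * wt (\<delta> * r) k"
          by (simp add: wt_def ennreal_mult[symmetric] powr_add[symmetric] algebra_simps)
        then have "epow (wt \<delta> (Suc k) * blk f (Suc k)) r
          = ennreal (2 powr (\<delta> * r)) * epow (wt \<delta> k * blk f (Suc k)) r"
          by (simp add: epow_mult epow_wt mult.assoc)
        also have "\<dots> \<le> ennreal (2 powr (\<delta> * r)) * epow (wt \<delta> k * ?L k) r"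
          using r by (intro mult_left_mono epow_mono) (auto split: nat.split)
        finally show ?thesis .
      qed
      then have "(\<Sum>k. epow (wt \<delta> (Suc k) * blk f (Suc k)) r)
        \<le> (\<Sum>k. ennreal (2 powr (\<delta> * r)) * epow (wt \<delta> k * ?L k) r)"
        by (intro suminf_le summableI)
      then show "(\<Sum>k. epow (wt \<delta> (Suc k) * blk f (Suc k)) r) \<le> ennreal (2 powr (\<delta> * r)) * ?S"
        by simp
    qed
    also have "\<dots> = ennreal (1 + 2 powr (\<delta> * r)) * ?S"
      by (simp add: distrib_right)
    also note mult_left_mono[OF *, of "ennreal (1 + 2 powr (\<delta> * r))"]
    finally show "block_sum \<delta> r f \<le> ennreal ((1 + 2 powr (\<delta> * r)) * (2 * ?E)) * ?\<Phi> f"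
      by (simp add: ennreal_mult mult.assoc add_nonneg_nonneg del: ennreal_plus)
  qed
qed

section \<open>Block estimates for the small and grand norms\<close>

text \<open>The weight \<open>-1/p\<close> equals \<open>\<delta> - 1/r\<close> for
  \<open>\<delta> = 1 - 1/p\<close> and \<open>r = 1\<close>. As \<open>p > 1\<close> makes
  \<open>\<delta>\<close> positive, the equivalence for integrals over \<open>(0, t)\<close> applies
  to the small norm itself.\<close>

lemma small_norm_eq:
  "small_norm p \<Omega> f = log_functional (1 - 1/p) 1 (\<lambda>t. epow (rint \<Omega> p f {0..t}) (1/p))"
  unfolding small_norm_def log_functional_def
proof (intro nn_integral_cong)
  fix t :: real
  show "indicator {0<..<1} t * ennreal ((1 - ln t) powr (- 1 / p) / t) * epow (rint \<Omega> p f {0..t}) (1 / p)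
    = indicator {0<..<1} t * (epow (ennreal ((1 - ln t) powr (1 - 1 / p - 1 / 1)) *
       epow (rint \<Omega> p f {0..t}) (1 / p)) 1 / ennreal t)"
  proof (cases "0 < t \<and> t < 1")
    case True
    then have "ennreal ((1 - ln t) powr (- 1 / p) / t)
      = ennreal ((1 - ln t) powr (- (1 / p))) * ennreal (1 / t)"
      by (simp add: ennreal_mult[symmetric])
    with True show ?thesis
      by (simp add: divide_ennreal_eq mult_ac)
  qed simp
qed

lemma equiv_small_norm: "equiv_on (meas_fun \<Omega>) (small_norm p \<Omega>) (\<lambda>f. \<Sum>k. wt (1 - 1/p) k * blk f k)"
  using equiv_lower_integral[of "1 - 1/p" 1] p_gt_1
  by (simp add: small_norm_eq[abs_def] block_sum_def[abs_def])

text \<open>The supremum is tested at the left endpoint of block \<open>k\<close>, where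
  \<open>[t, 1]\<close> contains the whole block and the logarithmic weight is still that of the
  block.\<close>

lemma grand_norm_ge: "wt (-1/p) k * blk f k \<le> ennreal (2 powr (1/p)) * grand_norm p \<Omega> f"
proof -
  let ?t = "cutoff (Suc k)"
  have "wt (-1/p) k \<le> ennreal (2 powr \<bar>-1/p\<bar>) * ennreal ((1 - ln ?t) powr (-1/p))"
    by (intro log_weight_block decseqD[OF decseq_cutoff]) auto
  then have "wt (-1/p) k * blk f k \<le> (ennreal (2 powr (1/p)) * ennreal ((1 - ln ?t) powr (-1/p)))
     * epow (rint \<Omega> p f {?t..1}) (1/p)"
    using p_gt_1 cutoff_le_1[of k] by (intro mult_mono blk_le) auto
  also have "\<dots> \<le> ennreal (2 powr (1/p)) * grand_norm p \<Omega> f"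
    unfolding grand_norm_def mult.assoc using cutoff_Suc_less_1[of k]
    by (intro mult_left_mono SUP_upper) auto
  finally show ?thesis .
qed

text \<open>Since \<open>wt (-1/p)\<close> decreases, the weight of the block containing
  \<open>t\<close> can be replaced by that of each earlier block met by \<open>[t, 1]\<close>; the
  resulting bound no longer depends on \<open>t\<close>.\<close>

lemma grand_norm_le:
  assumes f: "f \<in> meas_fun \<Omega>"
  shows "grand_norm p \<Omega> f \<le> ennreal (2 powr (1/p)) * (\<Sum>j. wt (-1/p) j * blk f j)"
  unfolding grand_norm_def
proof (rule SUP_least)
  fix t :: real assume t: "t \<in> {0<..<1}"
  then obtain k where k: "cutoff (Suc k) < t" "t \<le> cutoff k"
    using between_blocks[OF cutoff_tendsto, of t 0] by auto
  have "ennreal ((1 - ln t) powr (-1/p)) \<le> ennreal (2 powr \<bar>-1/p\<bar>) * wt (-1/p) k"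
    using k by (intro log_weight_block) auto
  then have "ennreal ((1 - ln t) powr (-1/p)) * epow (rint \<Omega> p f {t..1}) (1/p)
    \<le> (ennreal (2 powr (1/p)) * wt (-1/p) k) * (\<Sum>j. if j \<in> {..k} then blk f j else 0)"
    using p_gt_1 k by (intro mult_mono epow_rint_le_blocks f upper_interval_blocks) auto
  also have "\<dots> = ennreal (2 powr (1/p)) * (\<Sum>j. wt (-1/p) k * (if j \<in> {..k} then blk f j else 0))"
    by (simp add: mult.assoc)
  also have "\<dots> \<le> ennreal (2 powr (1/p)) * (\<Sum>j. wt (-1/p) j * blk f j)"
  proof (intro mult_left_mono suminf_le summableI)
    fix j
    show "wt (-1/p) k * (if j \<in> {..k} then blk f j else 0) \<le> wt (-1/p) j * blk f j"
      using p_gt_1 by (auto simp: wt_def divide_right_mono intro!: mult_right_mono ennreal_leI)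
  qed simp
  finally show "ennreal ((1 - ln t) powr (-1/p)) * epow (rint \<Omega> p f {t..1}) (1/p)
    \<le> ennreal (2 powr (1/p)) * (\<Sum>j. wt (-1/p) j * blk f j)" .
qed

end

subsection \<open>The K-functional\<close>

lemma powr_add_le:
  fixes x y p :: real
  assumes "0 \<le> x" "0 \<le> y" "0 \<le> p"
  shows "(x + y) powr p \<le> 2 powr p * (x powr p + y powr p)"
proof -
  have "(x + y) powr p \<le> (2 * max x y) powr p"
    using assms by (intro powr_mono2) auto
  also have "\<dots> = 2 powr p * max x y powr p"
    using assms by (simp add: powr_mult)
  also have "\<dots> \<le> 2 powr p * (x powr p + y powr p)"
    by (intro mult_left_mono) (auto simp: max_def)
  finally show ?thesis .
qed

section \<open>Dyadic discretization of the interpolation integral\<close>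

definition power_functional :: "real \<Rightarrow> real \<Rightarrow> (real \<Rightarrow> ennreal) \<Rightarrow> ennreal" where
  "power_functional \<theta> r K = (\<integral>\<^sup>+ t. indicator {0<..<1} t *
     (epow (ennreal (t powr (-\<theta>)) * K t) r / ennreal t) \<partial>lborel)"

lemma nn_integral_inverse_dyadic:
  "(\<integral>\<^sup>+ t. indicator {(1/2) ^ Suc k..(1/2) ^ k} t * ennreal (1 / t) \<partial>lborel) = ennreal (ln (2::real))"
  by (subst nn_integral_inverse_Icc) auto

lemma half_power_eq: "(1/2) ^ k = 2 powr (- real k)"
  by (simp add: powr_minus_divide powr_realpow power_one_over)

lemma power_functional_le:
  assumes "0 \<le> \<theta>" "0 < r" "\<And>k t. (1/2) ^ Suc k \<le> t \<Longrightarrow> t \<le> (1/2) ^ k \<Longrightarrow> K t \<le> U k"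
  shows "power_functional \<theta> r K \<le> ennreal (2 powr (\<theta> * r)) * (\<Sum>k. epow (wt \<theta> k * U k) r)"
proof -
  let ?c = "ennreal (2 powr (\<theta> * r))"
  have "power_functional \<theta> r K \<le> (\<Sum>k. (?c * epow (wt \<theta> k * U k) r) *
      (\<integral>\<^sup>+ t. indicator {(1/2) ^ Suc k..(1/2) ^ k} t * ennreal (1 / t) \<partial>lborel))"
    unfolding power_functional_def
  proof (rule nn_integral_blocks_le)
    show "(\<lambda>k. (1/2) ^ k :: real) \<longlonglongrightarrow> 0"
      by (rule LIMSEQ_power_zero) simp
    fix k and t :: real assume t: "(1/2) ^ Suc k \<le> t" "t \<le> (1/2) ^ k" "0 < t"
    have "t powr (- \<theta>) \<le> ((1/2) ^ Suc k) powr (- \<theta>)"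
      using t assms by (intro powr_mono2') auto
    also have "\<dots> = 2 powr \<theta> * 2 powr (\<theta> * real k)"
      unfolding half_power_eq powr_powr by (simp add: powr_add[symmetric] algebra_simps)
    finally have "ennreal (t powr (- \<theta>)) * K t \<le> (ennreal (2 powr \<theta>) * wt \<theta> k) * U k"
      using assms t by (intro mult_mono) (auto simp: wt_def ennreal_mult[symmetric] intro!: ennreal_leI)
    then have "epow (ennreal (t powr (- \<theta>)) * K t) r \<le> epow ((ennreal (2 powr \<theta>) * wt \<theta> k) * U k) r"
      using assms by (intro epow_mono) auto
    also have "\<dots> = ?c * epow (wt \<theta> k * U k) r"
      by (simp add: epow_mult epow_ennreal powr_powr mult.assoc)
    finally show "epow (ennreal (t powr (- \<theta>)) * K t) r / ennreal t
      \<le> ?c * epow (wt \<theta> k * U k) r * ennreal (1 / t)"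
      unfolding divide_ennreal_eq[OF t(3)] by (rule mult_right_mono) simp
  qed auto
  also have "\<dots> = ?c * ((\<Sum>k. epow (wt \<theta> k * U k) r) * ennreal (ln 2))"
    by (simp only: nn_integral_inverse_dyadic mult.assoc ennreal_suminf_cmult ennreal_suminf_multc)
  also have "\<dots> \<le> ?c * ((\<Sum>k. epow (wt \<theta> k * U k) r) * ennreal 1)"
    using ln_2_less_1 by (intro mult_left_mono ennreal_leI) auto
  finally show ?thesis by simp
qed

lemma power_functional_ge:
  assumes "0 \<le> \<theta>" "0 < r" "\<And>k t. (1/2) ^ Suc k \<le> t \<Longrightarrow> t \<le> (1/2) ^ k \<Longrightarrow> L k \<le> K t"
  shows "(\<Sum>k. epow (wt \<theta> k * L k) r) \<le> ennreal 2 * power_functional \<theta> r K"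
proof -
  let ?S = "\<Sum>k. epow (wt \<theta> k * L k) r"
  have "?S * ennreal (ln 2) = (\<Sum>k. epow (wt \<theta> k * L k) r *
      (\<integral>\<^sup>+ t. indicator {(1/2) ^ Suc k..(1/2) ^ k} t * ennreal (1 / t) \<partial>lborel))"
    by (simp only: nn_integral_inverse_dyadic ennreal_suminf_multc)
  also have "\<dots> \<le> power_functional \<theta> r K"
    unfolding power_functional_def
  proof (rule nn_integral_blocks_ge)
    show "decseq (\<lambda>k. (1/2) ^ k :: real)"
      by (auto simp: decseq_def intro!: power_decreasing)
    fix k and t :: real assume t: "(1/2) ^ Suc k < t" "t < (1/2) ^ k"
    then have t0: "0 < t" by (intro less_trans[OF _ t(1)]) simp
    have "2 powr (\<theta> * real k) = ((1/2) ^ k) powr (- \<theta>)"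
      unfolding half_power_eq powr_powr by (simp add: mult.commute)
    also have "\<dots> \<le> t powr (- \<theta>)"
      using t t0 assms by (intro powr_mono2') auto
    finally have "wt \<theta> k * L k \<le> ennreal (t powr (- \<theta>)) * K t"
      using assms t by (intro mult_mono) (auto simp: wt_def intro!: ennreal_leI)
    then show "epow (wt \<theta> k * L k) r * ennreal (1 / t)
      \<le> epow (ennreal (t powr (- \<theta>)) * K t) r / ennreal t"
      unfolding divide_ennreal_eq[OF t0] using assms by (intro mult_right_mono epow_mono) auto
  qed auto
  finally have *: "?S * ennreal (ln 2) \<le> power_functional \<theta> r K" .
  have "?S = ennreal 2 * (?S * ennreal (1/2))"
    unfolding mult.left_commute[of "ennreal 2"] by (simp only: ennreal_mult[symmetric]) simp
  also have "\<dots> \<le> ennreal 2 * (?S * ennreal (ln 2))"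
    using ln2_ge_two_thirds by (intro mult_left_mono ennreal_leI) auto
  also have "\<dots> \<le> ennreal 2 * power_functional \<theta> r K"
    using * by (rule mult_left_mono) simp
  finally show ?thesis .
qed

lemma interp_norm_eq:
  "interp_norm \<Omega> N0 N1 \<theta> r g = epow (power_functional \<theta> r (Kfun \<Omega> N0 N1 g)) (1/r)"
  by (simp add: interp_norm_def power_functional_def ennreal_times_divide)

lemma Kfun_le:
  assumes "g0 \<in> meas_fun \<Omega>" "g1 \<in> meas_fun \<Omega>" "\<And>x. x \<in> \<Omega> \<Longrightarrow> g x = g0 x + g1 x"
  shows "Kfun \<Omega> N0 N1 g t \<le> N0 g0 + ennreal t * N1 g1"
  unfolding Kfun_def using assms by (intro Inf_lower) blast

lemma le_Kfun:
  assumes "\<And>g0 g1. g0 \<in> meas_fun \<Omega> \<Longrightarrow> g1 \<in> meas_fun \<Omega> \<Longrightarrow> (\<And>x. x \<in> \<Omega> \<Longrightarrow> g x = g0 x + g1 x)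
    \<Longrightarrow> u \<le> N0 g0 + ennreal t * N1 g1"
  shows "u \<le> Kfun \<Omega> N0 N1 g t"
  unfolding Kfun_def by (rule Inf_greatest) (use assms in blast)

lemma Kfun_mono:
  assumes "s \<le> t"
  shows "Kfun \<Omega> N0 N1 g s \<le> Kfun \<Omega> N0 N1 g t"
proof (rule le_Kfun)
  fix g0 g1 assume "g0 \<in> meas_fun \<Omega>" "g1 \<in> meas_fun \<Omega>" "\<And>x. x \<in> \<Omega> \<Longrightarrow> g x = g0 x + g1 x"
  then have "Kfun \<Omega> N0 N1 g s \<le> N0 g0 + ennreal s * N1 g1"
    by (rule Kfun_le)
  also have "\<dots> \<le> N0 g0 + ennreal t * N1 g1"
    using assms by (intro add_left_mono mult_right_mono ennreal_leI) auto
  finally show "Kfun \<Omega> N0 N1 g s \<le> N0 g0 + ennreal t * N1 g1" .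
qed

text \<open>Ratio test: the exponent changes by \<open>e - 2 ^ i / p\<close> from \<open>i\<close>
  to \<open>i + 1\<close>, which is at most -1 for large \<open>i\<close> whatever the growth rate
  \<open>e\<close>.\<close>

lemma summable_superexponential:
  assumes "0 < p"
  shows "summable (\<lambda>i::nat. 2 powr (e * real i + (2 - 2 ^ i) / p))"
proof -
  obtain N :: nat where N: "(e + 1) * p \<le> real N"
    using real_arch_simple by blast
  show ?thesis
  proof (rule summable_ratio_test[of "1/2" N])
    fix i assume "i \<ge> N"
    have "(e + 1) * p \<le> 2 ^ i"
      using N \<open>i \<ge> N\<close> of_nat_less_two_power[of i, where 'a = real] by linarith
    then have "e + 1 \<le> 2 ^ i / p"
      using assms by (simp add: field_simps)
    then have "e * real (Suc i) + (2 - 2 ^ Suc i) / p \<le> -1 + (e * real i + (2 - 2 ^ i) / p)"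
      by (simp add: field_simps diff_divide_distrib add_divide_distrib)
    then have "2 powr (e * real (Suc i) + (2 - 2 ^ Suc i) / p) \<le> 2 powr (-1 + (e * real i + (2 - 2 ^ i) / p))"
      by (rule powr_mono) simp
    then show "norm (2 powr (e * real (Suc i) + (2 - 2 ^ Suc i) / p))
      \<le> 1/2 * norm (2 powr (e * real i + (2 - 2 ^ i) / p))"
      unfolding powr_add[of 2 "-1"] by (simp add: powr_minus_divide)
  qed simp
qed

section \<open>Two-sided block bounds for the K-functional\<close>

context grand_small begin

lemma blk_mono:
  assumes "g \<in> meas_fun \<Omega>" "\<And>s. cutoff (Suc k) \<le> s \<Longrightarrow> s \<le> cutoff k \<Longrightarrow> rearr \<Omega> g s \<le> rearr \<Omega> f s"
  shows "blk g k \<le> blk f k"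
  unfolding blk_def rint_def
proof (intro epow_mono nn_integral_mono)
  fix s
  show "indicator {cutoff (Suc k)..cutoff k} s * ennreal (rearr \<Omega> g s powr p)
    \<le> indicator {cutoff (Suc k)..cutoff k} s * ennreal (rearr \<Omega> f s powr p)"
  proof (cases "s \<in> {cutoff (Suc k)..cutoff k}")
    case True
    then have "0 < s" by (auto intro: less_le_trans[OF cutoff_pos])
    with True show ?thesis
      using assms p_gt_1 by (auto intro!: ennreal_leI powr_mono2 rearr_nonneg)
  qed simp
qed (use p_gt_1 in auto)

lemma blk_le_const:
  assumes "g \<in> meas_fun \<Omega>" "\<And>s. cutoff (Suc k) \<le> s \<Longrightarrow> s \<le> cutoff k \<Longrightarrow> rearr \<Omega> g s \<le> y" "0 \<le> y"
  shows "blk g k \<le> ennreal (y * cutoff k powr (1/p))"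
proof -
  have "rint \<Omega> p g {cutoff (Suc k)..cutoff k} \<le> (\<integral>\<^sup>+ s. ennreal (y powr p) * indicator {0..cutoff k} s \<partial>lborel)"
    unfolding rint_def
  proof (rule nn_integral_mono)
    fix s
    show "indicator {cutoff (Suc k)..cutoff k} s * ennreal (rearr \<Omega> g s powr p)
      \<le> ennreal (y powr p) * indicator {0..cutoff k} s"
    proof (cases "s \<in> {cutoff (Suc k)..cutoff k}")
      case True
      then have "0 < s" by (auto intro: less_le_trans[OF cutoff_pos])
      with True show ?thesis
        using assms p_gt_1 by (auto intro!: ennreal_leI powr_mono2 rearr_nonneg)
    qed simp
  qed
  also have "\<dots> = ennreal (y powr p * cutoff k)"
    by (subst nn_integral_cmult_indicator) (auto simp: ennreal_mult[symmetric] less_imp_le)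
  finally have "blk g k \<le> epow (ennreal (y powr p * cutoff k)) (1/p)"
    unfolding blk_def using p_gt_1 by (intro epow_mono) auto
  also have "\<dots> = ennreal (y * cutoff k powr (1/p))"
    using p_gt_1 assms by (simp add: epow_ennreal powr_mult powr_powr less_imp_le)
  finally show ?thesis .
qed

text \<open>The upper half \<open>[cutoff k / 2, cutoff k]\<close> lies in block \<open>k\<close>,
  and there the rearrangement is at least its value at \<open>cutoff k\<close>.\<close>

lemma blk_ge_const:
  assumes f: "f \<in> meas_fun \<Omega>"
  shows "ennreal (rearr \<Omega> f (cutoff k) * (cutoff k / 2) powr (1/p)) \<le> blk f k"
proof -
  let ?y = "rearr \<Omega> f (cutoff k)"
  have y: "0 \<le> ?y" by (intro rearr_nonneg f) simp
  have half: "{cutoff k / 2..cutoff k} \<subseteq> {cutoff (Suc k)..cutoff k}"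
    using cutoff_Suc_le[of k] by auto
  have "ennreal (?y powr p * (cutoff k / 2)) = (\<integral>\<^sup>+ s. ennreal (?y powr p) * indicator {cutoff k / 2..cutoff k} s \<partial>lborel)"
    by (subst nn_integral_cmult_indicator) (auto simp: ennreal_mult[symmetric] less_imp_le)
  also have "\<dots> \<le> rint \<Omega> p f {cutoff (Suc k)..cutoff k}"
    unfolding rint_def
  proof (rule nn_integral_mono)
    fix s
    show "ennreal (?y powr p) * indicator {cutoff k / 2..cutoff k} s
      \<le> indicator {cutoff (Suc k)..cutoff k} s * ennreal (rearr \<Omega> f s powr p)"
    proof (cases "s \<in> {cutoff k / 2..cutoff k}")
      case True
      then have "0 < s" using less_le_trans[of 0 "cutoff k / 2" s] by simp
      with True have "?y powr p \<le> rearr \<Omega> f s powr p"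
        using f y p_gt_1 by (auto intro!: powr_mono2 rearr_antimono)
      moreover have "s \<in> {cutoff (Suc k)..cutoff k}"
        using True half by blast
      ultimately show ?thesis
        using True by (simp add: ennreal_leI)
    qed simp
  qed
  finally have "epow (ennreal (?y powr p * (cutoff k / 2))) (1/p) \<le> blk f k"
    unfolding blk_def using p_gt_1 by (intro epow_mono) auto
  then show ?thesis
    using p_gt_1 y by (simp add: epow_ennreal powr_mult powr_powr less_imp_le powr_divide)
qed

text \<open>The substitution of \<open>2 * s\<close> for \<open>s\<close> brings the integral into
  the form where the rearrangement of a sum splits. It also spreads block \<open>k\<close> over
  blocks \<open>k\<close> and \<open>k + 1\<close> of the summands.\<close>

lemma blk_add_le:
  assumes f: "f \<in> meas_fun \<Omega>" and g: "g \<in> meas_fun \<Omega>" and h: "h \<in> meas_fun \<Omega>"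
    and eq: "\<And>x. x \<in> \<Omega> \<Longrightarrow> f x = g x + h x"
  shows "blk f k \<le> ennreal ((2 * 2 powr p) powr (1/p)) *
    ((blk g k + blk g (Suc k)) + (blk h k + blk h (Suc k)))"
proof -
  note [measurable] = measurable_rearr_powr[OF f, of p] measurable_rearr_powr[OF g, of p]
    measurable_rearr_powr[OF h, of p]
  let ?F = "\<lambda>f s. ennreal (rearr \<Omega> f s powr p)"
  let ?I = "\<lambda>k. {cutoff (Suc k)..cutoff k}"
  let ?i = "\<lambda>s. indicator (?I k) s + indicator (?I (Suc k)) s :: ennreal"
  let ?R = "\<lambda>f. rint \<Omega> p f (?I k) + rint \<Omega> p f (?I (Suc k))"
  have R: "(\<integral>\<^sup>+ s. ?i s * ?F u s \<partial>lborel) = ?R u" if "u \<in> meas_fun \<Omega>" for u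
    using measurable_rearr_powr[OF that, of p] by (simp add: rint_def distrib_right nn_integral_add)
  have "rint \<Omega> p f (?I k) = ennreal 2 * (\<integral>\<^sup>+ s. indicator (?I k) (2 * s) * ?F f (2 * s) \<partial>lborel)"
    unfolding rint_def
    using nn_integral_real_affine[of "\<lambda>s. indicator (?I k) s * ?F f s" 2 0] by simp
  also have "\<dots> \<le> ennreal 2 * (\<integral>\<^sup>+ s. ennreal (2 powr p) * (?i s * ?F g s + ?i s * ?F h s) \<partial>lborel)"
  proof (intro mult_left_mono nn_integral_mono)
    fix s :: real
    show "indicator (?I k) (2 * s) * ?F f (2 * s) \<le> ennreal (2 powr p) * (?i s * ?F g s + ?i s * ?F h s)"
    proof (cases "2 * s \<in> ?I k")
      case True
      then have "0 < s" using less_le_trans[OF cutoff_pos, of "Suc k" "2 * s"] by simp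
      \<comment> \<open>The left endpoint, halved, stays above \<open>cutoff (Suc (Suc k))\<close>.
        Adding the two indicators, rather than using that of the union, lets the integral split
        later.\<close>
      have "s \<in> ?I k \<union> ?I (Suc k)"
        using True cutoff_Suc_le[of "Suc k"] \<open>0 < s\<close> by auto
      then have i: "1 \<le> ?i s" by (auto simp: indicator_def)
      have "rearr \<Omega> f (s + s) \<le> rearr \<Omega> g s + rearr \<Omega> h s"
        using \<open>0 < s\<close> by (intro rearr_add_le f g h eq) auto
      then have "rearr \<Omega> f (2 * s) powr p \<le> (rearr \<Omega> g s + rearr \<Omega> h s) powr p"
        using \<open>0 < s\<close> p_gt_1 by (intro powr_mono2) (auto intro: rearr_nonneg f)
      also have "\<dots> \<le> 2 powr p * (rearr \<Omega> g s powr p + rearr \<Omega> h s powr p)"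
        using \<open>0 < s\<close> p_gt_1 by (intro powr_add_le rearr_nonneg g h) auto
      finally have "?F f (2 * s) \<le> ennreal (2 powr p) * (?F g s + ?F h s)"
        by (simp add: ennreal_leI ennreal_mult[symmetric] ennreal_plus[symmetric] del: ennreal_plus)
      also have "\<dots> \<le> ennreal (2 powr p) * (?i s * (?F g s + ?F h s))"
        using mult_right_mono[OF i, of "?F g s + ?F h s"] by (intro mult_left_mono) auto
      finally show ?thesis using True by (simp add: distrib_left)
    qed simp
  qed simp
  also have "\<dots> = ennreal 2 * (ennreal (2 powr p) * (?R g + ?R h))"
    by (subst nn_integral_cmult, simp, subst nn_integral_add) (simp_all add: R g h)
  also have "\<dots> = ennreal (2 * 2 powr p) * (?R g + ?R h)"
    by (simp add: ennreal_mult mult.assoc)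
  finally have "blk f k \<le> epow (ennreal (2 * 2 powr p) * (?R g + ?R h)) (1/p)"
    unfolding blk_def using p_gt_1 by (intro epow_mono) auto
  also have "\<dots> = ennreal ((2 * 2 powr p) powr (1/p)) * epow (?R g + ?R h) (1/p)"
    by (simp add: epow_mult epow_ennreal)
  also have "epow (?R g + ?R h) (1/p) \<le> epow (?R g) (1/p) + epow (?R h) (1/p)"
    using p_gt_1 by (intro epow_add_le) auto
  also have "\<dots> \<le> (blk g k + blk g (Suc k)) + (blk h k + blk h (Suc k))"
    unfolding blk_def using p_gt_1 by (intro add_mono epow_add_le) auto
  finally show ?thesis by (simp add: mult_left_mono)
qed

text \<open>Every decomposition must place a fixed part of block \<open>k\<close> of
  \<open>f\<close> into blocks \<open>k\<close> and \<open>k + 1\<close> of its summands, and each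
  such block is controlled by the norm of its summand. Only a lower bound on \<open>t\<close> is
  needed because the second norm carries the factor \<open>t\<close>.\<close>

lemma Kfun_ge:
  obtains C where "0 < C"
    "\<And>f k t. f \<in> meas_fun \<Omega> \<Longrightarrow> (1/2) ^ Suc k \<le> t \<Longrightarrow>
       wt (-1/p) k * blk f k \<le> ennreal C * Kfun \<Omega> (grand_norm p \<Omega>) (small_norm p \<Omega>) f t"
proof -
  obtain c where c: "0 < c"
    "\<And>f. f \<in> meas_fun \<Omega> \<Longrightarrow> (\<Sum>k. wt (1 - 1/p) k * blk f k) \<le> ennreal c * small_norm p \<Omega> f"
    using equiv_small_norm by (rule equiv_onE) blast
  define a where "a = 2 powr (1/p)"
  define A where "A = (2 * 2 powr p) powr (1/p)"
  \<comment> \<open>\<open>a\<close> pays for the weight of block \<open>k + 1\<close> in place of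
    \<open>k\<close> and for the grand-norm test; \<open>2 * c\<close> arises from the small norm.
    The maximum gives both summands one constant.\<close>
  define b where "b = max a (2 * c)"
  have pos: "0 < a" "0 < A" "0 < b" using c by (auto simp: a_def A_def b_def)
  have shift: "wt (-1/p) k * y \<le> ennreal a * (wt (-1/p) j * y)" if "j = k \<or> j = Suc k" for j k y
  proof -
    have "2 powr (-1/p * real k) \<le> a * 2 powr (-1/p * real j)"
      unfolding a_def powr_add[symmetric] using that p_gt_1
      by (intro powr_mono) (auto simp: field_simps)
    then have "wt (-1/p) k \<le> ennreal a * wt (-1/p) j"
      unfolding wt_def using pos by (simp add: ennreal_mult[symmetric] ennreal_leI del: times_divide_eq_left)
    then show ?thesis
      unfolding mult.assoc[symmetric] by (rule mult_right_mono) simp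
  qed
  have G: "wt (-1/p) k * blk g j \<le> ennreal (a * b) * grand_norm p \<Omega> g" if "j = k \<or> j = Suc k" for g j k
  proof -
    have "wt (-1/p) k * blk g j \<le> ennreal a * (ennreal a * grand_norm p \<Omega> g)"
      using shift[OF that] mult_left_mono[OF grand_norm_ge[of j g], of "ennreal a"]
      unfolding a_def by (auto intro: order_trans)
    also have "\<dots> \<le> ennreal a * (ennreal b * grand_norm p \<Omega> g)"
      by (intro mult_left_mono mult_right_mono ennreal_leI) (auto simp: b_def)
    finally show ?thesis using pos by (simp add: ennreal_mult mult.assoc)
  qed
  have S: "wt (-1/p) k * blk h j \<le> ennreal (a * b) * (ennreal t * small_norm p \<Omega> h)"
    if "j = k \<or> j = Suc k" "h \<in> meas_fun \<Omega>" "(1/2) ^ Suc k \<le> t" for h j k t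
  proof -
    have t: "0 \<le> t"
      using that(3) by (rule order_trans[rotated]) simp
    have "(1/2) ^ j \<le> (1/2::real) ^ k"
      using that(1) by (intro power_decreasing) auto
    with that(3) have "wt (-1) j \<le> ennreal (2 * t)"
      using half_power_eq[of j] by (simp add: wt_def ennreal_leI)
    have "wt (-1/p) k * blk h j \<le> ennreal a * (wt (-1/p) j * blk h j)"
      by (rule shift[OF that(1)])
    \<comment> \<open>The factor \<open>2 ^ -j\<close> converts the grand weight into the small
      weight, and it is at most \<open>2 * t\<close>.\<close>
    also have "wt (-1/p) j * blk h j = wt (-1) j * (wt (1 - 1/p) j * blk h j)"
      by (simp add: wt_mult')
    also have "\<dots> \<le> ennreal (2 * t) * (\<Sum>k. wt (1 - 1/p) k * blk h k)"
      using \<open>wt (-1) j \<le> ennreal (2 * t)\<close> by (intro mult_mono) (auto intro: le_suminf_ennreal)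
    also have "\<dots> \<le> ennreal (2 * t) * (ennreal c * small_norm p \<Omega> h)"
      by (intro mult_left_mono c that) auto
    also have "\<dots> = ennreal (2 * c) * (ennreal t * small_norm p \<Omega> h)"
      using c t by (simp add: ennreal_mult mult_ac)
    also have "\<dots> \<le> ennreal b * (ennreal t * small_norm p \<Omega> h)"
      by (intro mult_right_mono ennreal_leI) (auto simp: b_def)
    finally show ?thesis
      using pos by (simp add: ennreal_mult mult.assoc mult_left_mono)
  qed
  show ?thesis
  proof (rule that)
    show "0 < A * (2 * (a * b))" using pos by simp
    fix f k and t :: real assume f: "f \<in> meas_fun \<Omega>" and t: "(1/2) ^ Suc k \<le> t"
    let ?C = "A * (2 * (a * b))"
    have "ennreal (1 / ?C) * (wt (-1/p) k * blk f k) \<le> Kfun \<Omega> (grand_norm p \<Omega>) (small_norm p \<Omega>) f t"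
    proof (rule le_Kfun)
      fix g h assume g: "g \<in> meas_fun \<Omega>" and h: "h \<in> meas_fun \<Omega>"
        and eq: "\<And>x. x \<in> \<Omega> \<Longrightarrow> f x = g x + h x"
      let ?w = "wt (-1/p) k" and ?G = "grand_norm p \<Omega> g" and ?S = "ennreal t * small_norm p \<Omega> h"
      have "?w * blk f k \<le> ?w * (ennreal A * ((blk g k + blk g (Suc k)) + (blk h k + blk h (Suc k))))"
        unfolding A_def by (intro mult_left_mono blk_add_le f g h eq) auto
      also have "\<dots> = ennreal A * ((?w * blk g k + ?w * blk g (Suc k)) + (?w * blk h k + ?w * blk h (Suc k)))"
        by (simp add: distrib_left mult_ac)
      also have "\<dots> \<le> ennreal A * ((ennreal (a * b) * ?G + ennreal (a * b) * ?G) + (ennreal (a * b) * ?S + ennreal (a * b) * ?S))"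
        by (intro mult_left_mono add_mono G S h t) auto
      also have "\<dots> = ennreal ?C * (?G + ?S)"
        using pos by (simp add: ennreal_mult distrib_left mult_ac mult_2)
      finally show "ennreal (1 / ?C) * (?w * blk f k) \<le> ?G + ?S"
        using pos by (subst (asm) le_ennreal_mult_iff) auto
    qed
    then show "wt (-1/p) k * blk f k \<le> ennreal ?C * Kfun \<Omega> (grand_norm p \<Omega>) (small_norm p \<Omega>) f t"
      using pos by (subst le_ennreal_mult_iff) auto
  qed
qed

text \<open>Truncation at the level \<open>rearr \<Omega> f (cutoff k)\<close> concentrates the
  large part on a set of measure at most \<open>cutoff k\<close>, so it has only blocks from
  \<open>k\<close> on. The bounded part keeps the earlier blocks plus a tail that block
  \<open>k\<close> of \<open>f\<close> controls.\<close>

lemma Kfun_dyadic_le: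
  obtains C where "0 < C"
    "\<And>f k. f \<in> meas_fun \<Omega> \<Longrightarrow> Kfun \<Omega> (grand_norm p \<Omega>) (small_norm p \<Omega>) f ((1/2) ^ k) \<le>
       ennreal C * (wt (-1) k * (\<Sum>j. if j \<le> k then wt (1 - 1/p) j * blk f j else 0)
         + (\<Sum>j. if k \<le> j then wt (-1/p) j * blk f j else 0))"
proof -
  obtain c where c: "0 < c"
    "\<And>f. f \<in> meas_fun \<Omega> \<Longrightarrow> small_norm p \<Omega> f \<le> ennreal c * (\<Sum>k. wt (1 - 1/p) k * blk f k)"
    using equiv_small_norm by (rule equiv_onE) blast
  define a where "a = 2 powr (1/p)"
  \<comment> \<open>\<open>(1 - 1/p) * i\<close> is the growth of the small-norm weight over
    \<open>i\<close> further blocks; \<open>(2 - 2 ^ i) / p\<close> bounds, uniformly in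
    \<open>k\<close>, the exponent of the p-th root of \<open>cutoff (i + k)\<close> divided by
    \<open>cutoff k / 2\<close>.\<close>
  define x where "x i = 2 powr ((1 - 1/p) * real i + (2 - 2 ^ i) / p)" for i :: nat
  have summable: "summable x"
    unfolding x_def using p_gt_1 by (intro summable_superexponential) auto
  define D where "D = suminf x"
  have x_nonneg: "0 \<le> x i" for i
    by (simp add: x_def)
  have D: "0 \<le> D" "(\<Sum>i. ennreal (x i)) = ennreal D"
    using suminf_nonneg[OF summable x_nonneg] suminf_ennreal2[OF x_nonneg summable]
    by (simp_all add: D_def)
  have pos: "0 < a" by (simp add: a_def)
  show ?thesis
  proof (rule that)
    show "0 < max a (c * (1 + D))" using pos by simp
    fix f k assume f: "f \<in> meas_fun \<Omega>"
    have [measurable]: "f \<in> borel_measurable (lebesgue_on \<Omega>)"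
      using f by (simp add: meas_fun_def)
    define y where "y = rearr \<Omega> f (cutoff k)"
    have y: "0 \<le> y" unfolding y_def by (intro rearr_nonneg f cutoff_pos)
    \<comment> \<open>Each part is either \<open>f\<close> or 0 at every point, so both are
      dominated by \<open>\<bar>f\<bar>\<close> and their rearrangements by that of
      \<open>f\<close>.\<close>
    define g where "g = (\<lambda>x. if y < \<bar>f x\<bar> then f x else 0)"
    define h where "h = (\<lambda>x. if y < \<bar>f x\<bar> then 0 else f x)"
    have g: "g \<in> meas_fun \<Omega>" and h: "h \<in> meas_fun \<Omega>"
      by (simp_all add: g_def h_def meas_fun_def)
    have abs_le: "\<bar>g x\<bar> \<le> \<bar>f x\<bar>" "\<bar>h x\<bar> \<le> \<bar>f x\<bar>" "\<bar>h x\<bar> \<le> y" for x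
      using y by (auto simp: g_def h_def)
    have s_pos: "0 < s" if "cutoff (Suc j) \<le> s" for j s
      using less_le_trans[OF cutoff_pos that] .

    let ?G = "\<Sum>j. if k \<le> j then wt (-1/p) j * blk f j else 0"
    let ?H = "\<Sum>j. if j \<le> k then wt (1 - 1/p) j * blk f j else 0"
    have blk_g: "blk g j \<le> (if k \<le> j then blk f j else 0)" for j
    proof (cases "k \<le> j")
      case True
      then show ?thesis
        by (auto intro!: blk_mono rearr_mono f g s_pos abs_le)
    next
      case False
      \<comment> \<open>The support of \<open>g\<close> lies in the superlevel set of
        \<open>f\<close> at \<open>y\<close>, of measure at most \<open>cutoff k\<close>, so the
        rearrangement of \<open>g\<close> vanishes from \<open>cutoff k\<close> on.\<close>
      have "distf \<Omega> g 0 \<le> distf \<Omega> f y"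
        by (rule distf_mono[OF f]) (simp add: g_def split: if_splits)
      also have "\<dots> \<le> ennreal (cutoff k)"
        unfolding y_def by (rule distf_rearr_le[OF f cutoff_pos])
      finally have "distf \<Omega> g 0 \<le> ennreal (cutoff k)" .
      moreover have "cutoff k \<le> cutoff (Suc j)"
        using False by (intro decseqD[OF decseq_cutoff]) auto
      ultimately have "rearr \<Omega> g s \<le> 0" if "cutoff (Suc j) \<le> s" for s
        using that s_pos[OF that] g
        by (subst rearr_le_iff) (auto intro: order_trans ennreal_leI)
      then have "blk g j \<le> ennreal (0 * cutoff j powr (1/p))"
        by (intro blk_le_const g) auto
      then show ?thesis using False by simp
    qed
    have "grand_norm p \<Omega> g \<le> ennreal a * (\<Sum>j. wt (-1/p) j * blk g j)"
      unfolding a_def by (rule grand_norm_le[OF g])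
    also have "\<dots> \<le> ennreal a * (\<Sum>j. wt (-1/p) j * (if k \<le> j then blk f j else 0))"
      by (intro mult_left_mono suminf_le summableI blk_g) auto
    also have "\<dots> = ennreal a * ?G"
      by (auto intro!: arg_cong2[where f = "(*)"] suminf_cong)
    finally have G: "grand_norm p \<Omega> g \<le> ennreal a * ?G" .

    have blk_h: "blk h j \<le> blk f j" for j
      by (intro blk_mono rearr_mono f h s_pos abs_le)
    \<comment> \<open>Beyond block \<open>k\<close> the bounded part \<open>h\<close> only contributes \<open>y\<close> times superexponentially small
      lengths, and \<open>y (cutoff k / 2)\<^sup>1\<^sup>/\<^sup>p\<close> is at most the \<open>k\<close>-th block norm of \<open>f\<close>.\<close>
    have tail: "wt (1 - 1/p) (j + k) * blk h (j + k)
        \<le> ennreal (x j) * (wt (1 - 1/p) k * blk f k)" for j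
    proof -
      have "blk h (j + k) \<le> ennreal (y * cutoff (j + k) powr (1/p))"
        by (intro blk_le_const h rearr_le_bound y s_pos abs_le)
      also have "\<dots> \<le> ennreal (2 powr ((2 - 2 ^ j) / p) * (y * (cutoff k / 2) powr (1/p)))"
      proof (rule ennreal_leI)
        \<comment> \<open>This is \<open>(2 ^ k - 1) * (2 ^ j - 1) \<ge> 0\<close>, which decouples
          \<open>j\<close> from \<open>k\<close> in the exponent of
          \<open>cutoff (j + k)\<close>.\<close>
        have "(2::real) ^ j - 1 \<le> 2 ^ k * (2 ^ j - 1)"
          using mult_right_mono[of 1 "2 ^ k" "2 ^ j - 1 :: real"] by simp
        then have "1 - 2 ^ (j + k) \<le> (2 - 2 ^ j) + (1 - 2 ^ k) - (1::real)"
          by (simp add: power_add algebra_simps)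
        then have "cutoff (j + k) \<le> 2 powr ((2 - 2 ^ j) + (1 - 2 ^ k) - 1)"
          unfolding cutoff_def by (rule powr_mono) simp
        also have "\<dots> = 2 powr (2 - 2 ^ j) * (cutoff k / 2)"
          by (simp only: powr_diff[of 2 _ 1] powr_add cutoff_def) simp
        finally have "cutoff (j + k) \<le> 2 powr (2 - 2 ^ j) * (cutoff k / 2)" .
        then have "cutoff (j + k) powr (1/p) \<le> (2 powr (2 - 2 ^ j) * (cutoff k / 2)) powr (1/p)"
          using p_gt_1 by (intro powr_mono2) (auto simp: less_imp_le)
        also have "\<dots> = 2 powr ((2 - 2 ^ j) / p) * (cutoff k / 2) powr (1/p)"
          by (subst powr_mult) (simp_all add: powr_powr)
        finally have "y * cutoff (j + k) powr (1/p)
            \<le> y * (2 powr ((2 - 2 ^ j) / p) * (cutoff k / 2) powr (1/p))"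
          using y by (rule mult_left_mono)
        then show "y * cutoff (j + k) powr (1/p)
            \<le> 2 powr ((2 - 2 ^ j) / p) * (y * (cutoff k / 2) powr (1/p))"
          by (simp only: mult_ac)
      qed
      also have "\<dots> = ennreal (2 powr ((2 - 2 ^ j) / p)) * ennreal (y * (cutoff k / 2) powr (1/p))"
        using y by (simp add: ennreal_mult)
      also have "\<dots> \<le> ennreal (2 powr ((2 - 2 ^ j) / p)) * blk f k"
        unfolding y_def by (intro mult_left_mono blk_ge_const f) auto
      finally have "wt (1 - 1/p) (j + k) * blk h (j + k)
        \<le> wt (1 - 1/p) (j + k) * (ennreal (2 powr ((2 - 2 ^ j) / p)) * blk f k)"
        by (rule mult_left_mono) simp
      also have "\<dots> = (wt (1 - 1/p) (j + k) * ennreal (2 powr ((2 - 2 ^ j) / p))) * blk f k"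
        by (simp only: mult.assoc)
      also have "wt (1 - 1/p) (j + k) * ennreal (2 powr ((2 - 2 ^ j) / p)) = ennreal (x j) * wt (1 - 1/p) k"
        unfolding wt_def x_def by (simp add: ennreal_mult[symmetric] powr_add[symmetric] algebra_simps)
      finally show ?thesis by (simp only: mult.assoc)
    qed
    \<comment> \<open>Block \<open>k\<close> is put into the tail, as its index 0. The tail yields
      \<open>D\<close> and the earlier blocks yield 1 in the constant \<open>1 + D\<close>.\<close>
    have "(\<Sum>j. wt (1 - 1/p) j * blk h j)
      \<le> (\<Sum>j. ennreal (x j) * (wt (1 - 1/p) k * blk f k)) + (\<Sum>j<k. wt (1 - 1/p) j * blk f j)"
      by (subst suminf_offset[of _ k])
        (intro summableI add_mono suminf_le tail sum_mono mult_left_mono blk_h zero_le)+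
    also have "(\<Sum>j. ennreal (x j) * (wt (1 - 1/p) k * blk f k)) = ennreal D * (wt (1 - 1/p) k * blk f k)"
      by (simp only: ennreal_suminf_multc D)
    also have "wt (1 - 1/p) k * blk f k \<le> ?H"
      using le_suminf_ennreal[of "\<lambda>j. if j \<le> k then wt (1 - 1/p) j * blk f j else 0" k] by simp
    also have "(\<Sum>j<k. wt (1 - 1/p) j * blk f j) \<le> ?H"
    proof -
      have "(\<Sum>j<k. wt (1 - 1/p) j * blk f j)
        = (\<Sum>j<k. if j \<le> k then wt (1 - 1/p) j * blk f j else 0)"
        by (intro sum.cong) auto
      also have "\<dots> \<le> ?H"
        by (intro sum_le_suminf) (auto intro: summableI)
      finally show ?thesis .
    qed
    finally have "(\<Sum>j. wt (1 - 1/p) j * blk h j) \<le> ennreal D * ?H + ?H"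
      by (simp add: mult_left_mono)
    also have "\<dots> = ennreal (1 + D) * ?H"
      using D(1) by (simp add: distrib_right add.commute)
    finally have "ennreal c * (\<Sum>j. wt (1 - 1/p) j * blk h j) \<le> ennreal c * (ennreal (1 + D) * ?H)"
      by (rule mult_left_mono) simp
    with c(2)[OF h] have H: "small_norm p \<Omega> h \<le> ennreal (c * (1 + D)) * ?H"
      using c(1) D(1) by (simp add: ennreal_mult mult.assoc del: ennreal_plus)

    let ?C = "ennreal (max a (c * (1 + D)))"
    have "Kfun \<Omega> (grand_norm p \<Omega>) (small_norm p \<Omega>) f ((1/2) ^ k)
      \<le> grand_norm p \<Omega> g + ennreal ((1/2) ^ k) * small_norm p \<Omega> h"
      by (intro Kfun_le g h) (simp add: g_def h_def)
    also have "\<dots> \<le> ?C * ?G + wt (-1) k * (?C * ?H)"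
    proof (intro add_mono mult_mono)
      show "grand_norm p \<Omega> g \<le> ?C * ?G"
        by (rule order_trans[OF G]) (intro mult_right_mono ennreal_leI, auto)
      show "small_norm p \<Omega> h \<le> ?C * ?H"
        by (rule order_trans[OF H]) (intro mult_right_mono ennreal_leI, auto)
      show "ennreal ((1/2) ^ k) \<le> wt (-1) k"
        by (simp add: wt_def half_power_eq)
    qed auto
    finally show "Kfun \<Omega> (grand_norm p \<Omega>) (small_norm p \<Omega>) f ((1/2) ^ k) \<le> ?C * (wt (-1) k * ?H + ?G)"
      by (simp add: distrib_left mult_ac add.commute)
  qed
qed

text \<open>After multiplication by \<open>wt \<theta>\<close>, the sum over blocks up to
  \<open>k\<close> carries the weight exponent \<open>\<theta> - 1 < 0\<close> and the tail carries
  \<open>\<theta> > 0\<close>, so Hardy collapses both. Each leaves the total exponent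
  \<open>\<theta> - 1/p\<close>, the one that the lower bound also has.\<close>

lemma equiv_interp_norm:
  assumes \<theta>: "0 < \<theta>" "\<theta> < 1" and r: "1 \<le> r"
  shows "equiv_on (meas_fun \<Omega>) (interp_norm \<Omega> (grand_norm p \<Omega>) (small_norm p \<Omega>) \<theta> r)
     (\<lambda>f. epow (block_sum (\<theta> - 1/p) r f) (1/r))"
proof -
  let ?K = "Kfun \<Omega> (grand_norm p \<Omega>) (small_norm p \<Omega>)"
  obtain C where C: "0 < C"
    "\<And>f k. f \<in> meas_fun \<Omega> \<Longrightarrow> ?K f ((1/2) ^ k) \<le>
       ennreal C * (wt (-1) k * (\<Sum>j. if j \<le> k then wt (1 - 1/p) j * blk f j else 0)
         + (\<Sum>j. if k \<le> j then wt (-1/p) j * blk f j else 0))"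
    using Kfun_dyadic_le by blast
  obtain c where c: "0 < c" "\<And>f k t. f \<in> meas_fun \<Omega> \<Longrightarrow> (1/2) ^ Suc k \<le> t \<Longrightarrow>
       wt (-1/p) k * blk f k \<le> ennreal c * ?K f t"
    using Kfun_ge by blast
  obtain A where A: "0 < A" "\<And>c :: nat \<Rightarrow> ennreal.
    (\<Sum>k. epow (wt (\<theta> - 1) k * (\<Sum>j. if (\<theta> - 1) * (real k - real j) \<le> 0 then c j else 0)) r)
      \<le> ennreal A * (\<Sum>k. epow (wt (\<theta> - 1) k * c k) r)"
    using hardy_discrete[OF r, of "\<theta> - 1"] \<theta> by auto
  obtain B where B: "0 < B" "\<And>c :: nat \<Rightarrow> ennreal.
    (\<Sum>k. epow (wt \<theta> k * (\<Sum>j. if \<theta> * (real k - real j) \<le> 0 then c j else 0)) r)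
      \<le> ennreal B * (\<Sum>k. epow (wt \<theta> k * c k) r)"
    using hardy_discrete[OF r, of \<theta>] \<theta> by auto
  let ?N = "\<lambda>f. power_functional \<theta> r (?K f)"
  let ?E = "2 powr (\<theta> * r)" and ?R = "2 powr r * 2 powr (r - 1)"
  have "equiv_on (meas_fun \<Omega>) ?N (block_sum (\<theta> - 1/p) r)"
  proof (rule equiv_onI)
    show "0 < c powr r * 2" "0 < ?E * (C powr r * (?R * (A + B)))"
      using c C A B by auto
    fix f assume f: "f \<in> meas_fun \<Omega>"
    let ?X = "\<lambda>k. wt (\<theta> - 1) k * (\<Sum>j. if j \<le> k then wt (1 - 1/p) j * blk f j else 0)"
    let ?Y = "\<lambda>k. wt \<theta> k * (\<Sum>j. if k \<le> j then wt (-1/p) j * blk f j else 0)"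
    have "(\<theta> - 1) * (real k - real j) \<le> 0 \<longleftrightarrow> j \<le> k" "\<theta> * (real k - real j) \<le> 0 \<longleftrightarrow> k \<le> j" for j k
      using \<theta> by (auto simp: mult_le_0_iff)
    then have X: "(\<Sum>k. epow (?X k) r) \<le> ennreal A * block_sum (\<theta> - 1/p) r f"
      and Y: "(\<Sum>k. epow (?Y k) r) \<le> ennreal B * block_sum (\<theta> - 1/p) r f"
      using A(2)[of "\<lambda>j. wt (1 - 1/p) j * blk f j"] B(2)[of "\<lambda>j. wt (-1/p) j * blk f j"]
      by (simp_all add: wt_mult' block_sum_def)
    have "epow (wt \<theta> k * ?K f ((1/2) ^ k)) r
      \<le> ennreal (C powr r * ?R) * (epow (?X k) r + epow (?Y k) r)" for k
    proof -
      have "wt \<theta> k * ?K f ((1/2) ^ k) \<le> wt \<theta> k *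
        (ennreal C * (wt (-1) k * (\<Sum>j. if j \<le> k then wt (1 - 1/p) j * blk f j else 0)
         + (\<Sum>j. if k \<le> j then wt (-1/p) j * blk f j else 0)))"
        by (intro mult_left_mono C f) auto
      also have "\<dots> = ennreal C * (?X k + ?Y k)"
        by (simp add: distrib_left mult.left_commute[of _ "ennreal C"] wt_mult')
      finally have "epow (wt \<theta> k * ?K f ((1/2) ^ k)) r \<le> epow (ennreal C * (?X k + ?Y k)) r"
        using r by (intro epow_mono) auto
      also have "\<dots> = ennreal (C powr r) * epow (?X k + ?Y k) r"
        using C(1) by (simp add: epow_mult epow_ennreal)
      also have "\<dots> \<le> ennreal (C powr r) * (ennreal ?R * (epow (?X k) r + epow (?Y k) r))"
        by (intro mult_left_mono epow_add_le_const r) auto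
      finally show ?thesis by (simp add: ennreal_mult mult.assoc)
    qed
    then have "(\<Sum>k. epow (wt \<theta> k * ?K f ((1/2) ^ k)) r)
      \<le> (\<Sum>k. ennreal (C powr r * ?R) * (epow (?X k) r + epow (?Y k) r))"
      by (intro suminf_le summableI)
    also have "\<dots> = ennreal (C powr r * ?R) * ((\<Sum>k. epow (?X k) r) + (\<Sum>k. epow (?Y k) r))"
      unfolding ennreal_suminf_cmult by (subst suminf_add) (auto intro: summableI)
    also have "\<dots> \<le> ennreal (C powr r * ?R) *
        (ennreal A * block_sum (\<theta> - 1/p) r f + ennreal B * block_sum (\<theta> - 1/p) r f)"
      by (intro mult_left_mono add_mono X Y) auto
    also have "\<dots> = ennreal (C powr r * (?R * (A + B))) * block_sum (\<theta> - 1/p) r f"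
      using A(1) B(1) by (simp add: ennreal_mult distrib_right mult.assoc)
    finally have S: "(\<Sum>k. epow (wt \<theta> k * ?K f ((1/2) ^ k)) r)
      \<le> ennreal (C powr r * (?R * (A + B))) * block_sum (\<theta> - 1/p) r f" .
    \<comment> \<open>Since the K-functional increases in \<open>t\<close>, its value at the right
      end of each dyadic interval suffices.\<close>
    have "?N f \<le> ennreal ?E * (\<Sum>k. epow (wt \<theta> k * ?K f ((1/2) ^ k)) r)"
      using \<theta> r by (intro power_functional_le Kfun_mono) auto
    also note mult_left_mono[OF S, of "ennreal ?E"]
    finally show "?N f \<le> ennreal (?E * (C powr r * (?R * (A + B)))) * block_sum (\<theta> - 1/p) r f"
      using A(1) B(1) by (simp add: ennreal_mult mult.assoc)
    let ?L = "\<lambda>k. ennreal (1 / c) * (wt (-1/p) k * blk f k)"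
    have "(\<Sum>k. epow (wt \<theta> k * ?L k) r) \<le> ennreal 2 * ?N f"
      using \<theta> r c f by (intro power_functional_ge) (auto simp: le_ennreal_mult_iff)
    also have "(\<Sum>k. epow (wt \<theta> k * ?L k) r) = ennreal (1 / c powr r) * block_sum (\<theta> - 1/p) r f"
      using c(1) by (simp add: block_sum_def mult.left_commute[of _ "ennreal (1 / c)"] wt_mult'
          epow_mult[of "ennreal (1 / c)"] epow_ennreal powr_divide)
    finally show "block_sum (\<theta> - 1/p) r f \<le> ennreal (c powr r * 2) * ?N f"
      using c(1) le_ennreal_mult_iff[of "c powr r" "block_sum (\<theta> - 1/p) r f" "ennreal 2 * ?N f"]
      by (simp add: ennreal_mult mult.assoc)
  qed
  then show ?thesis
    using r equiv_on_epow[of _ ?N _ "1/r"] by (simp add: interp_norm_eq[abs_def])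
qed

subsection \<open>Lorentz--Zygmund norms\<close>

lemma LZ_norm_integrand:
  assumes "f \<in> meas_fun \<Omega>" "0 < t" "t < 1"
  shows "ennreal ((t powr (1/p) * (1 - ln t) powr \<beta> * rearr \<Omega> f t) powr p / t)
    = ennreal ((1 - ln t) powr (\<beta> * p)) * ennreal (rearr \<Omega> f t powr p)"
  using assms p_gt_1 rearr_nonneg[OF assms(1,2)]
  by (simp add: powr_mult powr_powr ennreal_mult[symmetric])

text \<open>With both indices equal to \<open>p\<close> the power of \<open>t\<close> cancels and
  the integrals add exactly over blocks. Only the logarithmic weight has to be frozen on each block,
  so no Hardy inequality intervenes and \<open>\<beta>\<close> may have any sign.\<close>

lemma equiv_LZ_norm:
  "equiv_on (meas_fun \<Omega>) (LZ_norm p p \<beta> \<Omega>) (\<lambda>f. epow (block_sum \<beta> p f) (1/p))"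
proof -
  let ?I = "\<lambda>k. {cutoff (Suc k)..cutoff k}"
  let ?g = "\<lambda>f t. ennreal ((t powr (1/p) * (1 - ln t) powr \<beta> * rearr \<Omega> f t) powr p / t)"
  let ?N = "\<lambda>f. \<integral>\<^sup>+ t. indicator {0<..<1} t * ?g f t \<partial>lborel"
  let ?c = "2 powr \<bar>\<beta> * p\<bar>"
  have block_sum: "ennreal x * block_sum \<beta> p f
    = (\<Sum>k. (ennreal x * wt (\<beta> * p) k) * (\<integral>\<^sup>+ t. indicator (?I k) t * ennreal (rearr \<Omega> f t powr p) \<partial>lborel))"
    for x f
    by (simp add: block_sum_def epow_mult epow_wt epow_blk rint_def mult.assoc)
  have "equiv_on (meas_fun \<Omega>) ?N (block_sum \<beta> p)"
  proof (rule equiv_onI)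
    show "0 < ?c" "0 < ?c" by simp_all
    fix f assume f: "f \<in> meas_fun \<Omega>"
    show "?N f \<le> ennreal ?c * block_sum \<beta> p f"
      unfolding block_sum
    proof (intro nn_integral_blocks_le cutoff_0 cutoff_tendsto measurable_rearr_powr f)
      fix k and t :: real assume t: "cutoff (Suc k) \<le> t" "t \<le> cutoff k" "0 < t" "t < 1"
      show "?g f t \<le> ennreal ?c * wt (\<beta> * p) k * ennreal (rearr \<Omega> f t powr p)"
        unfolding LZ_norm_integrand[OF f t(3,4)]
        by (intro mult_right_mono log_weight_block t) auto
    qed
    have "ennreal (1 / ?c) * block_sum \<beta> p f \<le> ?N f"
      unfolding block_sum
    proof (intro nn_integral_blocks_ge cutoff_0 cutoff_pos decseq_cutoff measurable_rearr_powr f)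
      fix k and t :: real assume t: "cutoff (Suc k) < t" "t < cutoff k"
      then have t01: "0 < t" "t < 1"
        using less_trans[OF cutoff_pos] less_le_trans[OF _ cutoff_le_1] by auto
      have "ennreal (1 / ?c) * wt (\<beta> * p) k \<le> ennreal ((1 - ln t) powr (\<beta> * p))"
        using log_weight_block(2)[of k t "\<beta> * p"] t by (simp add: le_ennreal_mult_iff)
      then show "ennreal (1 / ?c) * wt (\<beta> * p) k * ennreal (rearr \<Omega> f t powr p) \<le> ?g f t"
        unfolding LZ_norm_integrand[OF f t01] by (rule mult_right_mono) simp
    qed
    then show "block_sum \<beta> p f \<le> ennreal ?c * ?N f"
      by (simp add: le_ennreal_mult_iff)
  qed
  then show ?thesis
    using p_gt_1 equiv_on_epow[of _ ?N _ "1/p"] by (simp add: LZ_norm_def[abs_def])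
qed

lemma Lp_norm_eq_LZ_norm:
  assumes "f \<in> meas_fun \<Omega>"
  shows "Lp_norm p \<Omega> f = LZ_norm p p 0 \<Omega> f"
proof -
  have "indicator {0<..<1} t * ennreal (rearr \<Omega> f t powr p)
    = indicator {0<..<1} t *
      ennreal ((t powr (1/p) * (1 - ln t) powr 0 * rearr \<Omega> f t) powr p / t)" for t :: real
  proof (cases "0 < t \<and> t < 1")
    case True
    then have t: "0 < t" "t < 1" by auto
    \<comment> \<open>\<open>0 powr 0\<close> is 0, so the exponent 0 gives the weight 1 only for a
      nonzero base.\<close>
    have "1 - ln t \<noteq> 0"
      using ln_less_zero[OF t] by linarith
    then show ?thesis
      unfolding LZ_norm_integrand[OF assms t] by simp
  qed simp
  then show ?thesis
    unfolding Lp_norm_def LZ_norm_def nn_integral_powr_eq_rearr[OF assms] by (simp only:)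
qed

lemma interp_norm_equivalence:
  assumes "0 < \<theta>" "\<theta> < 1" "1 \<le> r" "equiv_on (meas_fun \<Omega>) N (block_sum (\<theta> - 1/p) r)"
  shows "equiv_on (meas_fun \<Omega>) (interp_norm \<Omega> (grand_norm p \<Omega>) (small_norm p \<Omega>) \<theta> r)
     (\<lambda>f. epow (N f) (1/r))"
  using assms
  by (intro equiv_on_trans[OF equiv_interp_norm equiv_on_sym] equiv_on_epow) auto

end

section \<open>The three regimes and the identification with Lebesgue and Lorentz-Zygmund
  spaces\<close>

theorem theorem6p2:
  fixes \<Omega> :: "'a::euclidean_space set" and p \<theta> r :: real
  assumes "open \<Omega>" and "bounded \<Omega>" and "emeasure lebesgue \<Omega> = 1"
    and "1 < p" and "0 < \<theta>" and "\<theta> < 1" and "1 \<le> r"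
  shows
   "(\<theta> < 1/p \<longrightarrow> equiv_on (meas_fun \<Omega>)
       (interp_norm \<Omega> (grand_norm p \<Omega>) (small_norm p \<Omega>) \<theta> r)
       (\<lambda>f. epow (\<integral>\<^sup>+ t. indicator {0<..<1} t *
           epow (ennreal ((1 - ln t) powr (\<theta> - 1/p - 1/r)) * epow (rint \<Omega> p f {t..1}) (1/p)) r
           / ennreal t \<partial>lborel) (1/r)))
  \<and> (\<theta> > 1/p \<longrightarrow> equiv_on (meas_fun \<Omega>)
       (interp_norm \<Omega> (grand_norm p \<Omega>) (small_norm p \<Omega>) \<theta> r)
       (\<lambda>f. epow (\<integral>\<^sup>+ t. indicator {0<..<1} t *
           epow (ennreal ((1 - ln t) powr (\<theta> - 1/p - 1/r)) * epow (rint \<Omega> p f {0..t}) (1/p)) r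
           / ennreal t \<partial>lborel) (1/r)))
  \<and> (\<theta> = 1/p \<longrightarrow> equiv_on (meas_fun \<Omega>)
       (interp_norm \<Omega> (grand_norm p \<Omega>) (small_norm p \<Omega>) \<theta> r)
       (\<lambda>f. epow (\<Sum>k. epow (rint \<Omega> p f {2 powr (1 - 2 ^ (k + 1)) .. 2 powr (1 - 2 ^ k)}) (r/p)) (1/r)))
  \<and> equiv_on (meas_fun \<Omega>)
       (interp_norm \<Omega> (grand_norm p \<Omega>) (small_norm p \<Omega>) (1/p) p) (Lp_norm p \<Omega>)
  \<and> (\<forall>\<eta>. 0 < \<eta> \<and> \<eta> < 1 \<longrightarrow> equiv_on (meas_fun \<Omega>)
       (interp_norm \<Omega> (grand_norm p \<Omega>) (small_norm p \<Omega>) \<eta> p) (LZ_norm p p (\<eta> - 1/p) \<Omega>))"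
proof -
  interpret grand_small \<Omega> p
    using assms by unfold_locales auto
  note \<theta>_r = \<open>0 < \<theta>\<close> \<open>\<theta> < 1\<close> \<open>1 \<le> r\<close>
  let ?Z = "interp_norm \<Omega> (grand_norm p \<Omega>) (small_norm p \<Omega>)"
  have LZ: "equiv_on (meas_fun \<Omega>) (?Z \<eta> p) (LZ_norm p p (\<eta> - 1/p) \<Omega>)" if "0 < \<eta>" "\<eta> < 1" for \<eta>
    using that p_gt_1 by (intro equiv_on_trans[OF equiv_interp_norm equiv_on_sym[OF equiv_LZ_norm]]) auto
  show ?thesis
  proof (intro conjI impI allI)
    assume "\<theta> < 1/p"
    then show "equiv_on (meas_fun \<Omega>) (?Z \<theta> r)
       (\<lambda>f. epow (\<integral>\<^sup>+ t. indicator {0<..<1} t *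
           epow (ennreal ((1 - ln t) powr (\<theta> - 1/p - 1/r)) * epow (rint \<Omega> p f {t..1}) (1/p)) r
           / ennreal t \<partial>lborel) (1/r))"
      using interp_norm_equivalence[OF \<theta>_r equiv_upper_integral] \<theta>_r
      by (simp add: log_functional_def ennreal_times_divide)
  next
    assume "\<theta> > 1/p"
    then show "equiv_on (meas_fun \<Omega>) (?Z \<theta> r)
       (\<lambda>f. epow (\<integral>\<^sup>+ t. indicator {0<..<1} t *
           epow (ennreal ((1 - ln t) powr (\<theta> - 1/p - 1/r)) * epow (rint \<Omega> p f {0..t}) (1/p)) r
           / ennreal t \<partial>lborel) (1/r))"
      using interp_norm_equivalence[OF \<theta>_r equiv_lower_integral] \<theta>_r
      by (simp add: log_functional_def ennreal_times_divide)
  next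
    \<comment> \<open>All block weights are 1 here, so the block sum is already the sum in the
      claim.\<close>
    assume "\<theta> = 1/p"
    then show "equiv_on (meas_fun \<Omega>) (?Z \<theta> r)
       (\<lambda>f. epow (\<Sum>k. epow (rint \<Omega> p f {2 powr (1 - 2 ^ (k + 1)) .. 2 powr (1 - 2 ^ k)}) (r/p)) (1/r))"
      using equiv_interp_norm[OF \<theta>_r] by (simp add: block_sum_def blk_def epow_epow cutoff_def)
  next
    \<comment> \<open>At \<open>\<eta> = 1/p\<close>, which lies in \<open>(0, 1)\<close>, the
      logarithmic exponent vanishes, and equimeasurability turns the norm into that of L^p.\<close>
    have "equiv_on (meas_fun \<Omega>) (?Z (1/p) p) (LZ_norm p p 0 \<Omega>)"
      using LZ[of "1/p"] p_gt_1 by simp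
    then show "equiv_on (meas_fun \<Omega>) (?Z (1/p) p) (Lp_norm p \<Omega>)"
      by (simp add: equiv_on_def Lp_norm_eq_LZ_norm)
  next
    fix \<eta> :: real assume "0 < \<eta> \<and> \<eta> < 1"
    then show "equiv_on (meas_fun \<Omega>) (?Z \<eta> p) (LZ_norm p p (\<eta> - 1/p) \<Omega>)"
      using LZ by simp
  qed
qed

end
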